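(* Let $M_0$ be a closed surface with simple Laplace spectrum, let $M_t$ be a localised perturbation of $M_0$ with eventually unperturbed part $M$, and let $\varphi_0$ be the $k$-th Laplace eigenfunction on $M_0$ and $\varphi_t$ the $k$-th Laplace eigenfunction on $M_t$ for a fixed $k\geq 1$, converging to $\varphi_0$ on $M$ (all in the sense described in the context). Assume that $M$ is a relatively compact subsurface of $M_0$ with smooth boundary, and that for $|t|$ small: (a) $0$ is a regular value of $\varphi_0|_M$ and of $\varphi_t|_M$; (b) there exists a fixed compact set $T\Subset\operatorname{int}(M)$ such that $\mathcal N(\varphi_0)\subset T$ and $\mathcal N(\varphi_t)\subset T$ for all small $|t|$; (c) each connected component of $M_0\setminus M$ meets at most one boundary component of $\partial M$. Then, for $|t|$ small, $$\nu(\varphi_t)\le\nu(\varphi_0).$$ If, in addition, each connected component of $M_t\setminus M$ also meets at most one boundary component of $\partial M$, then $$\nu(\varphi_t)=\nu(\varphi_0).$$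
   Context: Setting of localised perturbations. $M_0$ and $M_t$ are closed (compact, connected, without boundary) Riemannian surfaces, $(M_t)$ being a one-parameter family; the topology of $M_t$ may differ from that of $M_0$. The Laplace spectrum of $M_0$ is simple. The parameter $t$ tends to $0$ (possibly along a sequence) in such a way that $\lambda_j(M_t)\to\lambda_j(M_0)$ for every $j\ge1$, where $\lambda_1\le\lambda_2\le\cdots$ are the eigenvalues of $-\Delta$ (positive semidefinite Laplace–Beltrami operator). There are a subset $M\subset M_0$ (the eventually unperturbed part) and, for all small $|t|$, smooth embeddings $\iota_t:M\hookrightarrow M_t$, with $\iota_0$ the inclusion, such that $\iota_t\to\iota_0$ in $C^\infty$ on compact subsets of $\operatorname{int}(M)$ (since the targets differ, read this after identification: $\iota_t^*g_{M_t}\to g_{M_0}$ in $C^\infty$ on compact subsets of $\operatorname{int}(M)$). $M$ is identified with $\iota_t(M)\subset M_t$; thus $M_t\setminus M$ means $M_t\setminus\iota_t(M)$, $\varphi_t|_M$ means $\varphi_t\circ\iota_t$, and $\mathcal N(\varphi_t)\subset T$ means $\mathcal N(\varphi_t)\subset\iota_t(T)$. The $k$-th eigenfunctions satisfy $\varphi_t\circ\iota_t\to\varphi_0$ in $C^\infty_{\mathrm{loc}}(\operatorname{int}(M))$. $\mathcal N(\varphi)$ is the full zero set of $\varphi$ on its surface ($M_0$ or $M_t$), and $\nu(\varphi)$ is the number of connected components of the complement of $\mathcal N(\varphi)$ in that surface. A connected component of $M_0\setminus M$ or $M_t\setminus M$ "meets" a boundary component of $\partial M$ if its closure intersects it. 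*)

theory Defs
  imports "HOL-Analysis.Analysis" "HOL-Library.Function_Algebras"
begin

section \<open>Smooth functions on open subsets of the plane\<close>

definition partial :: "2 \<Rightarrow> (real^2 \<Rightarrow> 'v::real_normed_vector) \<Rightarrow> real^2 \<Rightarrow> 'v" where
  "partial i f z = frechet_derivative f (at z) (axis i 1)"

definition iter_partial :: "2 list \<Rightarrow> (real^2 \<Rightarrow> 'v::real_normed_vector) \<Rightarrow> real^2 \<Rightarrow> 'v" where
  "iter_partial l f = foldr partial l f"

(* Only used for open W. *)
definition smooth_on :: "(real^2) set \<Rightarrow> (real^2 \<Rightarrow> 'v::real_normed_vector) \<Rightarrow> bool" where
  "smooth_on W f \<longleftrightarrow> (\<forall>l. iter_partial l f differentiable_on W)"

definition jacobian :: "(real^2 \<Rightarrow> real^2) \<Rightarrow> real^2 \<Rightarrow> real^2^2" where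
  "jacobian f z = matrix (frechet_derivative f (at z))"

(* Convergence in C^infinity on compact subsets of an open set W, along a filter of parameters. *)
definition Cinf_loc_limit ::
  "(real^2) set \<Rightarrow> ('t \<Rightarrow> real^2 \<Rightarrow> 'v::real_normed_vector) \<Rightarrow> (real^2 \<Rightarrow> 'v) \<Rightarrow> 't filter \<Rightarrow> bool" where
  "Cinf_loc_limit W f g F \<longleftrightarrow>
     (\<forall>K l. compact K \<and> K \<subseteq> W \<longrightarrow>
        uniform_limit K (\<lambda>t. iter_partial l (f t)) (iter_partial l g) F)"


section \<open>Riemannian surfaces\<close>

type_synonym 'a chart = "'a set \<times> ('a \<Rightarrow> real^2)"

abbreviation chart_dom :: "'a chart \<Rightarrow> 'a set" where "chart_dom c \<equiv> fst c"
abbreviation chart_map :: "'a chart \<Rightarrow> 'a \<Rightarrow> real^2" where "chart_map c \<equiv> snd c"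

definition chart_inv :: "'a chart \<Rightarrow> real^2 \<Rightarrow> 'a" where
  "chart_inv c = inv_into (chart_dom c) (chart_map c)"

definition is_chart :: "'a topology \<Rightarrow> 'a chart \<Rightarrow> bool" where
  "is_chart X c \<longleftrightarrow> openin X (chart_dom c) \<and> open (chart_map c ` chart_dom c) \<and>
     homeomorphic_map (subtopology X (chart_dom c)) (top_of_set (chart_map c ` chart_dom c)) (chart_map c)"

definition transition :: "'a chart \<Rightarrow> 'a chart \<Rightarrow> real^2 \<Rightarrow> real^2" where
  "transition c d = chart_map d \<circ> chart_inv c"

definition compatible :: "'a chart \<Rightarrow> 'a chart \<Rightarrow> bool" where
  "compatible c d \<longleftrightarrow>
     smooth_on (chart_map c ` (chart_dom c \<inter> chart_dom d)) (transition c d) \<and>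
     smooth_on (chart_map d ` (chart_dom c \<inter> chart_dom d)) (transition d c)"

definition maximal_smooth_atlas :: "'a topology \<Rightarrow> 'a chart set \<Rightarrow> bool" where
  "maximal_smooth_atlas X C \<longleftrightarrow>
     (\<forall>c\<in>C. is_chart X c) \<and> (\<Union>c\<in>C. chart_dom c) = topspace X \<and>
     (\<forall>c\<in>C. \<forall>d\<in>C. compatible c d) \<and>
     (\<forall>c. is_chart X c \<and> (\<forall>d\<in>C. compatible c d) \<longrightarrow> c \<in> C)"

(* The metric is given by its coefficient matrix (g_ij) in every chart, as a function of the
   coordinates; tensoriality is imposed in riemannian_metric. *)
record 'a surface =
  surf_top :: "'a topology"
  surf_charts :: "'a chart set"
  surf_metric :: "'a chart \<Rightarrow> real^2 \<Rightarrow> real^2^2"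

abbreviation points :: "'a surface \<Rightarrow> 'a set" where "points S \<equiv> topspace (surf_top S)"

definition riemannian_metric :: "'a surface \<Rightarrow> bool" where
  "riemannian_metric S \<longleftrightarrow>
     (\<forall>c\<in>surf_charts S.
        smooth_on (chart_map c ` chart_dom c) (surf_metric S c) \<and>
        (\<forall>z\<in>chart_map c ` chart_dom c.
           transpose (surf_metric S c z) = surf_metric S c z \<and>
           (\<forall>v. v \<noteq> 0 \<longrightarrow> v \<bullet> (surf_metric S c z *v v) > 0)) \<and>
        (\<forall>d\<in>surf_charts S. \<forall>z\<in>chart_map c ` (chart_dom c \<inter> chart_dom d).
           surf_metric S c z =
             transpose (jacobian (transition c d) z) ** surf_metric S d (transition c d z)
               ** jacobian (transition c d) z))"

definition closed_riemannian_surface :: "'a surface \<Rightarrow> bool" where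
  "closed_riemannian_surface S \<longleftrightarrow>
     points S \<noteq> {} \<and> compact_space (surf_top S) \<and> connected_space (surf_top S) \<and>
     Hausdorff_space (surf_top S) \<and>
     maximal_smooth_atlas (surf_top S) (surf_charts S) \<and> riemannian_metric S"


section \<open>The Laplace spectrum\<close>

definition smooth_function :: "'a surface \<Rightarrow> ('a \<Rightarrow> real) \<Rightarrow> bool" where
  "smooth_function S f \<longleftrightarrow>
     (\<forall>c\<in>surf_charts S. smooth_on (chart_map c ` chart_dom c) (f \<circ> chart_inv c))"

(* Laplace-Beltrami operator in coordinates:
   (1 / sqrt |g|) d_i (sqrt |g| g^ij d_j u). *)
definition coord_laplacian :: "(real^2 \<Rightarrow> real^2^2) \<Rightarrow> (real^2 \<Rightarrow> real) \<Rightarrow> real^2 \<Rightarrow> real" where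
  "coord_laplacian g u z =
     (\<Sum>i\<in>UNIV. partial i
        (\<lambda>w. sqrt (det (g w)) * (\<Sum>j\<in>UNIV. matrix_inv (g w) $ i $ j * partial j u w)) z)
     / sqrt (det (g z))"

definition solves_eigen_equation :: "'a surface \<Rightarrow> real \<Rightarrow> ('a \<Rightarrow> real) \<Rightarrow> bool" where
  "solves_eigen_equation S \<mu> f \<longleftrightarrow> smooth_function S f \<and>
     (\<forall>c\<in>surf_charts S. \<forall>p\<in>chart_dom c.
        - coord_laplacian (surf_metric S c) (f \<circ> chart_inv c) (chart_map c p) = \<mu> * f p)"

definition laplace_eigenfunction :: "'a surface \<Rightarrow> real \<Rightarrow> ('a \<Rightarrow> real) \<Rightarrow> bool" where
  "laplace_eigenfunction S \<mu> f \<longleftrightarrow> solves_eigen_equation S \<mu> f \<and> (\<exists>p\<in>points S. f p \<noteq> 0)"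

(* Functions on S are represented by functions on the whole type vanishing off S, so that
   the dimension below is that of the genuine eigenspace. *)
definition eigenspace :: "'a surface \<Rightarrow> real \<Rightarrow> ('a \<Rightarrow> real) set" where
  "eigenspace S \<mu> = {f. solves_eigen_equation S \<mu> f \<and> (\<forall>p. p \<notin> points S \<longrightarrow> f p = 0)}"

lemma vector_space_pointwise: "vector_space (\<lambda>(a::real) (f::'a \<Rightarrow> real) p. a * f p)"
  by unfold_locales (auto simp: fun_eq_iff algebra_simps)

definition eigen_multiplicity :: "'a surface \<Rightarrow> real \<Rightarrow> nat" where
  "eigen_multiplicity S \<mu> =
     vector_space.dim (\<lambda>(a::real) (f::'a \<Rightarrow> real) p. a * f p) (eigenspace S \<mu>)"

(* lam 1 \<le> lam 2 \<le> ... lists all eigenvalues with multiplicity; on a closed connected surface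
   lam 1 = 0. The value lam 0 is irrelevant. *)
definition laplace_spectrum :: "'a surface \<Rightarrow> (nat \<Rightarrow> real) \<Rightarrow> bool" where
  "laplace_spectrum S lam \<longleftrightarrow> mono_on {1..} lam \<and>
     (\<forall>\<mu>. finite {j. 1 \<le> j \<and> lam j = \<mu>} \<and> card {j. 1 \<le> j \<and> lam j = \<mu>} = eigen_multiplicity S \<mu>)"

definition simple_spectrum :: "'a surface \<Rightarrow> bool" where
  "simple_spectrum S \<longleftrightarrow>
     (\<forall>\<mu>. (\<exists>f. laplace_eigenfunction S \<mu> f) \<longrightarrow> eigen_multiplicity S \<mu> = 1)"


section \<open>Nodal sets and nodal domains\<close>

definition nodal_set :: "'a surface \<Rightarrow> ('a \<Rightarrow> real) \<Rightarrow> 'a set" where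
  "nodal_set S f = {p \<in> points S. f p = 0}"

(* By Courant's theorem there are finitely many nodal domains of an eigenfunction, so the
   convention that card is 0 on infinite sets plays no role. *)
definition nodal_count :: "'a surface \<Rightarrow> ('a \<Rightarrow> real) \<Rightarrow> nat" where
  "nodal_count S f =
     card (connected_components_of (subtopology (surf_top S) (points S - nodal_set S f)))"

(* f is only considered on the subset M, which may have boundary: the differential of f
   at a point of M is the derivative within M. *)
definition regular_value_on :: "'a surface \<Rightarrow> 'a set \<Rightarrow> ('a \<Rightarrow> real) \<Rightarrow> real \<Rightarrow> bool" where
  "regular_value_on S M f y \<longleftrightarrow>
     (\<forall>p\<in>M. f p = y \<longrightarrow> (\<forall>c\<in>surf_charts S. p \<in> chart_dom c \<longrightarrow>
        (\<exists>D. ((f \<circ> chart_inv c) has_derivative D)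
                (at (chart_map c p) within chart_map c ` (M \<inter> chart_dom c)) \<and>
             D \<noteq> (\<lambda>_. 0))))"


section \<open>Localised perturbations\<close>

(* M is closed and contains its manifold boundary, which is then its topological frontier. *)
definition compact_subsurface :: "'a surface \<Rightarrow> 'a set \<Rightarrow> bool" where
  "compact_subsurface S M \<longleftrightarrow> compactin (surf_top S) M \<and>
     (\<forall>p\<in>surf_top S frontier_of M. \<exists>c\<in>surf_charts S. p \<in> chart_dom c \<and> chart_map c p $ 2 = 0 \<and>
        M \<inter> chart_dom c = {q \<in> chart_dom c. 0 \<le> chart_map c q $ 2})"

(* Smoothness on a subset M that need not be open: near every point, the coordinate expression
   is the restriction of a smooth map h defined on an open subset of the plane. *)
definition smooth_embedding :: "'a surface \<Rightarrow> 'a set \<Rightarrow> 'b surface \<Rightarrow> ('a \<Rightarrow> 'b) \<Rightarrow> bool" where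
  "smooth_embedding S M S' \<iota> \<longleftrightarrow>
     embedding_map (subtopology (surf_top S) M) (surf_top S') \<iota> \<and>
     (\<forall>c\<in>surf_charts S. \<forall>d\<in>surf_charts S'. \<forall>p\<in>M \<inter> chart_dom c. \<iota> p \<in> chart_dom d \<longrightarrow>
        (\<exists>W h. open W \<and> chart_map c p \<in> W \<and> smooth_on W h \<and>
           inj (frechet_derivative h (at (chart_map c p))) \<and>
           (\<forall>q\<in>M \<inter> chart_dom c. chart_map c q \<in> W \<longrightarrow>
              \<iota> q \<in> chart_dom d \<and> chart_map d (\<iota> q) = h (chart_map c q))))"

(* Coefficient matrix in the chart c of the pullback of the metric of S'. It does not depend on
   the chart d of S' around the image point. *)
definition pullback_metric ::
  "'b surface \<Rightarrow> ('a \<Rightarrow> 'b) \<Rightarrow> 'a chart \<Rightarrow> real^2 \<Rightarrow> real^2^2" where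
  "pullback_metric S' \<iota> c z =
     (let d = (SOME d. d \<in> surf_charts S' \<and> \<iota> (chart_inv c z) \<in> chart_dom d);
          F = chart_map d \<circ> \<iota> \<circ> chart_inv c
      in transpose (jacobian F z) ** surf_metric S' d (F z) ** jacobian F z)"

(* t tends to 0 through the parameter set A, which may be a neighbourhood of 0 or
   the range of a sequence. The base surface is S 0. *)
definition localised_perturbation ::
  "real set \<Rightarrow> (real \<Rightarrow> 'a surface) \<Rightarrow> 'a set \<Rightarrow> (real \<Rightarrow> 'a \<Rightarrow> 'a) \<Rightarrow> (real \<Rightarrow> nat \<Rightarrow> real) \<Rightarrow> bool" where
  "localised_perturbation A S M \<iota> lam \<longleftrightarrow>
     0 islimpt A \<and>
     (\<forall>t\<in>insert 0 A. closed_riemannian_surface (S t) \<and> laplace_spectrum (S t) (lam t)) \<and>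
     simple_spectrum (S 0) \<and>
     (\<forall>j\<ge>1. ((\<lambda>t. lam t j) \<longlongrightarrow> lam 0 j) (at 0 within A)) \<and>
     M \<subseteq> points (S 0) \<and>
     (\<forall>p\<in>M. \<iota> 0 p = p) \<and>
     (\<forall>\<^sub>F t in at 0 within A. smooth_embedding (S 0) M (S t) (\<iota> t)) \<and>
     (\<forall>c\<in>surf_charts (S 0).
        Cinf_loc_limit (chart_map c ` (chart_dom c \<inter> surf_top (S 0) interior_of M))
          (\<lambda>t. pullback_metric (S t) (\<iota> t) c) (surf_metric (S 0) c) (at 0 within A))"

definition functions_Cinf_loc_limit ::
  "'a surface \<Rightarrow> 'a set \<Rightarrow> ('t \<Rightarrow> 'a \<Rightarrow> real) \<Rightarrow> ('a \<Rightarrow> real) \<Rightarrow> 't filter \<Rightarrow> bool" where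
  "functions_Cinf_loc_limit S W f g F \<longleftrightarrow>
     (\<forall>c\<in>surf_charts S.
        Cinf_loc_limit (chart_map c ` (chart_dom c \<inter> W))
          (\<lambda>t. f t \<circ> chart_inv c) (g \<circ> chart_inv c) F)"

(* Every component of X - P meets (with its closure) at most one of the sets in \<B>. *)
definition complement_components_meet_at_most_one :: "'a topology \<Rightarrow> 'a set \<Rightarrow> 'a set set \<Rightarrow> bool" where
  "complement_components_meet_at_most_one X P \<B> \<longleftrightarrow>
     (\<forall>C\<in>connected_components_of (subtopology X (topspace X - P)).
        \<forall>B\<in>\<B>. \<forall>B'\<in>\<B>. (X closure_of C) \<inter> B \<noteq> {} \<and> (X closure_of C) \<inter> B' \<noteq> {} \<longrightarrow> B = B')"

definition boundary_components :: "'a surface \<Rightarrow> 'a set \<Rightarrow> 'a set set" where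
  "boundary_components S M =
     connected_components_of (subtopology (surf_top S) (surf_top S frontier_of M))"

end

theory Submission imports Defs begin

text \<open>Condition (c) says that a complementary component of \<open>M\<close> never joins two components of
  \<open>M - \<N>(\<phi>)\<close>, so \<open>\<nu>(\<phi>\<^sub>0)\<close> is the number of components of \<open>M - \<N>(\<phi>\<^sub>0)\<close>. Without this
  condition on the surface \<open>S t\<close>, complementary components can still only merge components of
  \<open>M - \<N>(\<phi>\<^sub>t)\<close>, which gives \<open>\<le>\<close>. It remains to compare \<open>M - \<N>(\<phi>\<^sub>t)\<close> with \<open>M - \<N>(\<phi>\<^sub>0)\<close>.
  Instead of constructing an isotopy, cover \<open>M\<close> by finitely many closed pieces on which both
  functions have connected positive and negative parts: pieces where the sign is constant, and, by
  \<open>C\<^sup>1\<close> convergence, cylinders around zeros in which the functions increase along the axis. The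
  signed parts of the pieces form finite covers whose nerves determine the components, and the
  two nerves have the same components for small \<open>t\<close>. Near \<open>\<partial>M\<close>, where nothing converges, the
  sign of \<open>\<phi>\<^sub>t\<close> is carried from the interior of \<open>M\<close> by half-discs disjoint from \<open>T\<close>.\<close>

section \<open>Nerves of finite closed covers\<close>

text \<open>Overlaps of closed pieces are not stable: pieces that share only zeros of
  \<open>\<phi> 0\<close> may overlap in a signed part of \<open>\<phi> t\<close>. Hence the two
  nerves need not coincide, and it is only shown that a new overlap joins pieces already lying in
  one component. Since the cover is finite, finitely many conditions, each valid for small
  \<open>t\<close>, suffice, and no rate of convergence enters. This is where it matters that both
  surfaces are two-dimensional: the image of the interior of \<open>M\<close> is open by invariance
  of domain. The base surface requires no separate argument, being an embedded piece problem for the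
  identity.\<close>

lemma trancl_cover_chain:
  assumes fin: "finite J" and cl: "\<And>j. j \<in> J \<Longrightarrow> closedin Z (V j)"
    and cov: "topspace Z \<subseteq> (\<Union>j\<in>J. V j)"
    and i: "i \<in> J" "x \<in> V i" and j: "j \<in> J" "y \<in> V j" and xy: "connected_component_of Z x y"
  shows "(i, j) \<in> {(i, j). i \<in> J \<and> j \<in> J \<and> V i \<inter> V j \<noteq> {}}\<^sup>+"
proof -
  define E where "E = {(i, j). i \<in> J \<and> j \<in> J \<and> V i \<inter> V j \<noteq> {}}"
  \<comment> \<open>The pieces reached from \<open>V i\<close> by chains of overlaps. Their union
    \<open>A\<close> and the union \<open>B\<close> of the others are closed by finiteness of
    \<open>J\<close> and disjoint by maximality, so a connected set through \<open>x\<close> stays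
    in \<open>A\<close>. The index \<open>i\<close> itself belongs to \<open>R\<close> because
    \<open>V i\<close> contains \<open>x\<close> and thus meets itself.\<close>
  define R where "R = {l \<in> J. (i, l) \<in> E\<^sup>+}"
  define A where "A = (\<Union>l\<in>R. V l)"
  define B where "B = (\<Union>l\<in>J-R. V l)"
  have iR: "i \<in> R"
    using i by (auto simp: R_def E_def)
  have step: "l' \<in> R" if "l \<in> R" "l' \<in> J" "V l \<inter> V l' \<noteq> {}" for l l'
  proof -
    have "(l, l') \<in> E" using that by (auto simp: E_def R_def)
    then show ?thesis
      using that by (auto simp: R_def intro: trancl_into_trancl)
  qed
  have cA: "closedin Z A" and cB: "closedin Z B"
    unfolding A_def B_def using fin cl by (auto intro!: closedin_Union simp: R_def)
  have AB: "A \<inter> B = {}"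
    using step unfolding A_def B_def by fast
  have un: "topspace Z \<subseteq> A \<union> B"
    using cov unfolding A_def B_def by blast
  obtain K where K: "connectedin Z K" "x \<in> K" "y \<in> K"
    using xy by (auto simp: connected_component_of_def)
  have "x \<in> A"
    using i iR by (auto simp: A_def)
  moreover have "K \<subseteq> A \<union> B" "A \<inter> B \<inter> K = {}"
    using AB un connectedin_subset_topspace[OF K(1)] by auto
  ultimately have "B \<inter> K = {}"
    using K cA cB unfolding connectedin_closedin by blast
  then have "y \<in> A"
    using un K connectedin_subset_topspace[OF K(1)] by blast
  then obtain l where "l \<in> R" "y \<in> V l"
    by (auto simp: A_def)
  then have "j \<in> R"
    using step j by blast
  then show ?thesis
    by (simp add: R_def E_def)
qed

text \<open>Used to count components through representatives: with \<open>f\<close> and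
  \<open>g\<close> sending a representative to its component in two spaces, only the two equivalence
  relations on the representatives have to be compared.\<close>

lemma card_image_eq_if_same_kernel:
  assumes "\<And>x y. x \<in> I \<Longrightarrow> y \<in> I \<Longrightarrow> f x = f y \<longleftrightarrow> g x = g y"
  shows "card (f ` I) = card (g ` I)"
proof -
  define h where "h = (\<lambda>u. g (SOME x. x \<in> I \<and> f x = u))"
  have h: "h (f x) = g x" if "x \<in> I" for x
  proof -
    have "(SOME y. y \<in> I \<and> f y = f x) \<in> I \<and> f (SOME y. y \<in> I \<and> f y = f x) = f x"
      by (rule someI) (use that in auto)
    then show ?thesis
      unfolding h_def using assms that by blast
  qed
  have "bij_betw h (f ` I) (g ` I)"
    unfolding bij_betw_def inj_on_def image_image
    using h assms by (auto intro!: image_cong)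
  then show ?thesis
    by (rule bij_betw_same_card)
qed

text \<open>In \<open>linked\<close> the pieces of \<open>Z\<close> need not intersect but only lie in the same component: pieces
  of \<open>Y\<close> may overlap where the corresponding pieces of \<open>Z\<close> merely touch.\<close>

lemma card_components_eq_by_covers:
  assumes fin: "finite J"
    and V: "\<And>j. j \<in> J \<Longrightarrow> closedin Z (V j)" "\<And>j. j \<in> J \<Longrightarrow> connectedin Z (V j)"
      "topspace Z \<subseteq> (\<Union>j\<in>J. V j)"
    and U: "\<And>j. j \<in> J \<Longrightarrow> closedin Y (U j)" "\<And>j. j \<in> J \<Longrightarrow> connectedin Y (U j)"
      "topspace Y \<subseteq> (\<Union>j\<in>J. U j)"
    and persist: "\<And>i j. i \<in> J \<Longrightarrow> j \<in> J \<Longrightarrow> V i \<inter> V j \<noteq> {} \<Longrightarrow> U i \<inter> U j \<noteq> {}"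
    and linked: "\<And>i j. i \<in> J \<Longrightarrow> j \<in> J \<Longrightarrow> U i \<inter> U j \<noteq> {} \<Longrightarrow>
        \<exists>x\<in>V i. \<exists>y\<in>V j. connected_component_of Z x y"
  shows "finite (connected_components_of Z)" "finite (connected_components_of Y)"
    "card (connected_components_of Z) = card (connected_components_of Y)"
proof -
  define I where "I = {j \<in> J. V j \<noteq> {}}"
  \<comment> \<open>The diagonal cases \<open>i = j\<close> of \<open>persist\<close> and
    \<open>linked\<close> say that corresponding pieces are empty simultaneously, so one index set
    serves both covers.\<close>
  have I': "I = {j \<in> J. U j \<noteq> {}}"
    unfolding I_def using persist linked by fastforce
  have finI: "finite I"
    using fin by (simp add: I_def)
  define v where "v = (\<lambda>j. SOME x. x \<in> V j)"
  define u where "u = (\<lambda>j. SOME x. x \<in> U j)"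
  have v: "v j \<in> V j" if "j \<in> I" for j
    using that unfolding v_def I_def by (auto intro: someI)
  have u: "u j \<in> U j" if "j \<in> I" for j
    using that unfolding u_def I' by (auto intro: someI)
  have vZ: "v j \<in> topspace Z" if "j \<in> I" for j
    using v[OF that] V(2) connectedin_subset_topspace that by (fastforce simp: I_def)
  have uY: "u j \<in> topspace Y" if "j \<in> I" for j
    using u[OF that] U(2) connectedin_subset_topspace that by (fastforce simp: I_def)
  have ccV: "connected_component_of Z x (v j)" if "j \<in> I" "x \<in> V j" for j x
    using that v V(2) by (auto simp: connected_component_of_def I_def)
  have ccU: "connected_component_of Y x (u j)" if "j \<in> I" "x \<in> U j" for j x
    using that u U(2) by (auto simp: connected_component_of_def I_def)
  let ?C = "\<lambda>j. connected_component_of_set Z (v j)"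
  let ?D = "\<lambda>j. connected_component_of_set Y (u j)"
  have compZ: "connected_components_of Z = ?C ` I"
  proof
    show "?C ` I \<subseteq> connected_components_of Z"
      using vZ by (auto simp: connected_components_of_def)
    show "connected_components_of Z \<subseteq> ?C ` I"
    proof
      fix K assume "K \<in> connected_components_of Z"
      then obtain x where x: "x \<in> topspace Z" "K = connected_component_of_set Z x"
        by (auto simp: connected_components_of_def)
      then obtain j where "j \<in> I" "x \<in> V j"
        using V(3) unfolding I_def by blast
      then show "K \<in> ?C ` I"
        using x ccV by (metis connected_component_of_equiv image_eqI)
    qed
  qed
  have compY: "connected_components_of Y = ?D ` I"
  proof
    show "?D ` I \<subseteq> connected_components_of Y"
      using uY by (auto simp: connected_components_of_def)
    show "connected_components_of Y \<subseteq> ?D ` I"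
    proof
      fix K assume "K \<in> connected_components_of Y"
      then obtain x where x: "x \<in> topspace Y" "K = connected_component_of_set Y x"
        by (auto simp: connected_components_of_def)
      then obtain j where "j \<in> I" "x \<in> U j"
        using U(3) unfolding I' by blast
      then show "K \<in> ?D ` I"
        using x ccU by (metis connected_component_of_equiv image_eqI)
    qed
  qed
  \<comment> \<open>Lying in one component is a transitive relation on indices, so it absorbs the
    transitive closure of every relation it contains. Chains of overlaps in one cover therefore stay
    in one component of the other space.\<close>
  let ?rY = "{(i, j). i \<in> I \<and> j \<in> I \<and> connected_component_of Y (u i) (u j)}"
  let ?rZ = "{(i, j). i \<in> I \<and> j \<in> I \<and> connected_component_of Z (v i) (v j)}"
  have tY: "trans ?rY" and tZ: "trans ?rZ"
    unfolding trans_def using connected_component_of_trans by fast+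
  have VU: "connected_component_of Y (u i) (u j)"
    if ij: "i \<in> I" "j \<in> I" "connected_component_of Z (v i) (v j)" for i j
  proof -
    have "(i, j) \<in> {(i, j). i \<in> J \<and> j \<in> J \<and> V i \<inter> V j \<noteq> {}}\<^sup>+"
      by (rule trancl_cover_chain[OF fin V(1,3), of _ "v i" _ "v j"])
         (use ij v in \<open>auto simp: I_def\<close>)
    moreover have "{(i, j). i \<in> J \<and> j \<in> J \<and> V i \<inter> V j \<noteq> {}} \<subseteq> ?rY"
    proof clarify
      fix i j assume h: "i \<in> J" "j \<in> J" "V i \<inter> V j \<noteq> {}"
      then obtain x where x: "x \<in> U i" "x \<in> U j"
        using persist by blast
      then have "i \<in> I" "j \<in> I"
        using h by (auto simp: I')
      then show "i \<in> I \<and> j \<in> I \<and> connected_component_of Y (u i) (u j)"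
        using ccU x connected_component_of_trans connected_component_of_sym by metis
    qed
    ultimately have "(i, j) \<in> ?rY\<^sup>+"
      by (meson trancl_mono)
    then show ?thesis
      using trancl_id[OF tY] by simp
  qed
  have UV: "connected_component_of Z (v i) (v j)"
    if ij: "i \<in> I" "j \<in> I" "connected_component_of Y (u i) (u j)" for i j
  proof -
    have "(i, j) \<in> {(i, j). i \<in> J \<and> j \<in> J \<and> U i \<inter> U j \<noteq> {}}\<^sup>+"
      by (rule trancl_cover_chain[OF fin U(1,3), of _ "u i" _ "u j"])
         (use ij u in \<open>auto simp: I_def\<close>)
    moreover have "{(i, j). i \<in> J \<and> j \<in> J \<and> U i \<inter> U j \<noteq> {}} \<subseteq> ?rZ"
    proof clarify
      fix i j assume h: "i \<in> J" "j \<in> J" "U i \<inter> U j \<noteq> {}"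
      then obtain x y where x: "x \<in> V i" "y \<in> V j" "connected_component_of Z x y"
        using linked by blast
      then have "i \<in> I" "j \<in> I"
        using h by (auto simp: I_def)
      then show "i \<in> I \<and> j \<in> I \<and> connected_component_of Z (v i) (v j)"
        using ccV x connected_component_of_trans connected_component_of_sym by metis
    qed
    ultimately have "(i, j) \<in> ?rZ\<^sup>+"
      by (meson trancl_mono)
    then show ?thesis
      using trancl_id[OF tZ] by simp
  qed
  show "finite (connected_components_of Z)" "finite (connected_components_of Y)"
    using finI by (auto simp: compZ compY)
  show "card (connected_components_of Z) = card (connected_components_of Y)"
    unfolding compZ compY
  proof (rule card_image_eq_if_same_kernel)
    fix i j assume "i \<in> I" "j \<in> I"
    then show "?C i = ?C j \<longleftrightarrow> ?D i = ?D j"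
      using VU UV vZ uY by (metis connected_component_of_eq Collect_inj)
  qed
qed

section \<open>Stability of the components of a nonvanishing set\<close>

text \<open>The closure condition excludes that \<open>Q\<close> touches a zero of \<open>g\<close> from one side only, where a part
  of \<open>Q\<close> with the other sign could appear for \<open>f t\<close>.\<close>

definition sign_piece :: "'t filter \<Rightarrow> 'a topology \<Rightarrow> ('t \<Rightarrow> 'a \<Rightarrow> real) \<Rightarrow> ('a \<Rightarrow> real) \<Rightarrow> 'a set \<Rightarrow> bool" where
  "sign_piece F Y f g Q \<longleftrightarrow> closedin Y Q \<and>
     (\<forall>\<sigma>\<in>{1, -1}. connectedin Y {x\<in>Q. 0 < \<sigma> * g x} \<and>
        (\<forall>x\<in>Q. g x = 0 \<longrightarrow> x \<in> Y closure_of {x\<in>Q. 0 < \<sigma> * g x}) \<and>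
        (\<forall>\<^sub>F t in F. connectedin Y {x\<in>Q. 0 < \<sigma> * f t x}))"

text \<open>Where \<open>h\<close> does not vanish, the strict inequality agrees with the weak one,
  and that one is a closed condition.\<close>

lemma closedin_positive_part:
  assumes "closedin Y Q" "continuous_map Y euclideanreal h"
  shows "closedin (subtopology Y {x\<in>topspace Y. h x \<noteq> 0}) {x\<in>Q. 0 < \<sigma> * h x}"
proof (cases "\<sigma> = 0")
  case False
  have "closedin Y {x \<in> topspace Y. \<sigma> * h x \<in> {0..}}"
    by (rule closedin_continuous_map_preimage[where Y = euclideanreal])
       (use assms(2) in \<open>auto intro: continuous_map_real_mult\<close>)
  then have "closedin Y (Q \<inter> {x \<in> topspace Y. \<sigma> * h x \<in> {0..}})"
    using assms(1) by blast
  moreover have "{x\<in>Q. 0 < \<sigma> * h x} =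
      (Q \<inter> {x \<in> topspace Y. \<sigma> * h x \<in> {0..}}) \<inter> {x\<in>topspace Y. h x \<noteq> 0}"
    using closedin_subset[OF assms(1)] False by (auto simp: less_le)
  ultimately show ?thesis
    unfolding closedin_subtopology by blast
qed auto

text \<open>The range of \<open>t\<close> in \<open>sign\<close> depends on the point; compactness
  of \<open>K\<close> leaves finitely many neighbourhoods and hence a common range.\<close>

lemma eventually_sgn_eq_on_closed:
  assumes comp: "compact_space Y"
    and sign: "\<And>p. p \<in> topspace Y \<Longrightarrow> g p \<noteq> 0 \<Longrightarrow>
        \<exists>U. openin Y U \<and> p \<in> U \<and> (\<forall>\<^sub>F t in F. \<forall>x\<in>U. sgn (f t x) = sgn (g x :: real))"
    and K: "closedin Y K" "\<And>x. x \<in> K \<Longrightarrow> g x \<noteq> 0"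
  shows "\<forall>\<^sub>F t in F. \<forall>x\<in>K. sgn (f t x) = sgn (g x)"
proof -
  let ?\<U> = "{U. openin Y U \<and> (\<forall>\<^sub>F t in F. \<forall>x\<in>U. sgn (f t x) = sgn (g x))}"
  have "compactin Y K"
    using comp K(1) closedin_compact_space by blast
  moreover have "K \<subseteq> \<Union>?\<U>"
    using sign K closedin_subset[OF K(1)] by blast
  ultimately obtain \<F> where \<F>: "finite \<F>" "\<F> \<subseteq> ?\<U>" "K \<subseteq> \<Union>\<F>"
    unfolding compactin_def by (metis (no_types, lifting) mem_Collect_eq)
  have "\<forall>\<^sub>F t in F. \<forall>U\<in>\<F>. \<forall>x\<in>U. sgn (f t x) = sgn (g x)"
    using \<F> by (intro eventually_ball_finite) auto
  then show ?thesis
    by eventually_elim (use \<F>(3) in blast)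
qed

text \<open>Both nonvanishing sets are covered by signed parts of the same finitely many pieces,
  indexed by pairs \<open>(Q, \<sigma>)\<close>. A point common to two parts of \<open>g\<close> is
  not a zero of \<open>g\<close>, so it stays common for \<open>f t\<close>. The delicate direction
  is the converse, where pieces meet at zeros of \<open>g\<close>.\<close>

lemma eventually_card_components_nonzero:
  fixes g :: "'a \<Rightarrow> real"
  assumes comp: "compact_space Y"
    and contg: "continuous_map Y euclideanreal g"
    and contf: "\<forall>\<^sub>F t in F. continuous_map Y euclideanreal (f t)"
    and sign: "\<And>p. p \<in> topspace Y \<Longrightarrow> g p \<noteq> 0 \<Longrightarrow>
        \<exists>U. openin Y U \<and> p \<in> U \<and> (\<forall>\<^sub>F t in F. \<forall>x\<in>U. sgn (f t x) = sgn (g x))"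
    and piece: "\<And>p. p \<in> topspace Y \<Longrightarrow> \<exists>Q. p \<in> Y interior_of Q \<and> sign_piece F Y f g Q"
  shows "\<forall>\<^sub>F t in F.
      finite (connected_components_of (subtopology Y {x\<in>topspace Y. g x \<noteq> 0})) \<and>
      finite (connected_components_of (subtopology Y {x\<in>topspace Y. f t x \<noteq> 0})) \<and>
      card (connected_components_of (subtopology Y {x\<in>topspace Y. g x \<noteq> 0})) =
      card (connected_components_of (subtopology Y {x\<in>topspace Y. f t x \<noteq> 0}))"
proof -
  let ?Z = "\<lambda>h. subtopology Y {x\<in>topspace Y. h x \<noteq> (0::real)}"
  let ?V = "\<lambda>h (Q, \<sigma>). {x\<in>Q. 0 < \<sigma> * (h x :: real)}"
  note sgnK = eventually_sgn_eq_on_closed[of Y g f F, OF comp sign]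
  let ?\<U> = "(interior_of) Y ` {Q. sign_piece F Y f g Q}"
  have "(\<forall>U\<in>?\<U>. openin Y U) \<and> topspace Y \<subseteq> \<Union>?\<U>"
    using piece by auto
  then obtain \<F> where "finite \<F>" "\<F> \<subseteq> ?\<U>" "topspace Y \<subseteq> \<Union>\<F>"
    using comp unfolding compact_space_alt by meson
  then obtain \<Q> where \<Q>: "finite \<Q>" "\<Q> \<subseteq> {Q. sign_piece F Y f g Q}" "\<F> = (interior_of) Y ` \<Q>"
    by (metis finite_subset_image)
  have cov: "topspace Y \<subseteq> \<Union>\<Q>"
    using \<open>topspace Y \<subseteq> \<Union>\<F>\<close> interior_of_subset unfolding \<Q>(3) by fast
  have good: "sign_piece F Y f g Q" if "Q \<in> \<Q>" for Q
    using \<Q>(2) that by auto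
  have cl: "closedin Y Q" if "Q \<in> \<Q>" for Q
    using good[OF that] by (simp add: sign_piece_def)
  define J where "J = \<Q> \<times> {1, -1::real}"
  have finJ: "finite J"
    using \<Q>(1) by (simp add: J_def)
  have conn_g: "connectedin Y (?V g j)" if "j \<in> J" for j
    using that good by (auto simp: J_def sign_piece_def)
  have E1: "\<forall>\<^sub>F t in F. \<forall>j\<in>J. connectedin Y (?V (f t) j)"
    using finJ good by (intro eventually_ball_finite) (auto simp: J_def sign_piece_def)
  have E2: "\<forall>\<^sub>F t in F. \<forall>i\<in>J. \<forall>j\<in>J. ?V g i \<inter> ?V g j \<noteq> {} \<longrightarrow> ?V (f t) i \<inter> ?V (f t) j \<noteq> {}"
  proof (intro eventually_ball_finite[OF finJ] ballI)
    fix i j assume ij: "i \<in> J" "j \<in> J"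
    obtain Q \<sigma> R \<tau> where [simp]: "i = (Q, \<sigma>)" "j = (R, \<tau>)"
      by (cases i, cases j)
    show "\<forall>\<^sub>F t in F. ?V g i \<inter> ?V g j \<noteq> {} \<longrightarrow> ?V (f t) i \<inter> ?V (f t) j \<noteq> {}"
    proof (cases "?V g i \<inter> ?V g j = {}")
      case False
      then obtain x where x: "x \<in> Q" "x \<in> R" "0 < \<sigma> * g x" "0 < \<tau> * g x"
        by auto
      then have "x \<in> topspace Y" "g x \<noteq> 0"
        using ij cl closedin_subset by (fastforce simp: J_def)+
      then have "\<forall>\<^sub>F t in F. sgn (f t x) = sgn (g x)"
        using sign by (fastforce elim: eventually_mono)
      then show ?thesis
      proof eventually_elim
        case (elim t)
        have "sgn (\<sigma> * f t x) = sgn (\<sigma> * g x)" "sgn (\<tau> * f t x) = sgn (\<tau> * g x)"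
          using elim by (auto simp: sgn_mult)
        then have "0 < \<sigma> * f t x" "0 < \<tau> * f t x"
          using x by (metis sgn_greater)+
        then show ?case
          using x by auto
      qed
    qed simp
  qed
  have E3: "\<forall>\<^sub>F t in F. \<forall>i\<in>J. \<forall>j\<in>J. ?V (f t) i \<inter> ?V (f t) j \<noteq> {} \<longrightarrow>
      (\<exists>x\<in>?V g i. \<exists>y\<in>?V g j. connected_component_of (?Z g) x y)"
  proof (intro eventually_ball_finite[OF finJ] ballI)
    fix i j assume ij: "i \<in> J" "j \<in> J"
    obtain Q \<sigma> R \<tau> where [simp]: "i = (Q, \<sigma>)" "j = (R, \<tau>)"
      by (cases i, cases j)
    have Q: "closedin Y Q" "closedin Y R" and \<sigma>: "\<sigma> \<in> {1, -1}" "\<tau> \<in> {1, -1}"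
      and QR: "Q \<in> \<Q>" "R \<in> \<Q>"
      using ij cl by (auto simp: J_def)
    show "\<forall>\<^sub>F t in F. ?V (f t) i \<inter> ?V (f t) j \<noteq> {} \<longrightarrow>
      (\<exists>x\<in>?V g i. \<exists>y\<in>?V g j. connected_component_of (?Z g) x y)"
    proof (cases "\<exists>x\<in>?V g i. \<exists>y\<in>?V g j. connected_component_of (?Z g) x y")
      case unlinked: False
      show ?thesis
      proof (cases "\<sigma> = \<tau>")
        case True
        \<comment> \<open>Suppose no point of one part is connected to a point of the other. At a
          zero \<open>x\<close> in \<open>Q \<inter> R\<close>, the closure conditions of
          \<open>Q\<close> and \<open>R\<close> give points \<open>u\<close> and \<open>v\<close> of
          the two parts inside a third piece \<open>W\<close> around \<open>x\<close>, and the
          connected signed part of \<open>W\<close> would join them. So \<open>g\<close> has the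
          opposite sign on the closed set \<open>Q \<inter> R\<close>; that sign persists and no new
          overlap arises.\<close>
        have neg: "\<sigma> * g x < 0" if x: "x \<in> Q \<inter> R" for x
        proof (rule ccontr)
          assume "\<not> \<sigma> * g x < 0"
          then consider "0 < \<sigma> * g x" | "g x = 0"
            using \<sigma> by force
          then show False
          proof cases
            case 1
            have "x \<in> topspace (?Z g)"
              using x Q closedin_subset 1 by fastforce
            then show False
              using unlinked x 1 True by (fastforce simp: connected_component_of_refl)
          next
            case 2
            have xY: "x \<in> topspace Y"
              using x Q closedin_subset by blast
            then obtain W where W: "x \<in> Y interior_of W" "sign_piece F Y f g W"
              using piece by blast
            have "x \<in> Y closure_of {x\<in>Q. 0 < \<sigma> * g x}" "x \<in> Y closure_of {x\<in>R. 0 < \<sigma> * g x}"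
              using good[OF QR(1)] good[OF QR(2)] x 2 \<sigma> by (auto simp: sign_piece_def)
            then obtain u v where u: "u \<in> Q" "0 < \<sigma> * g u" "u \<in> Y interior_of W"
              and v: "v \<in> R" "0 < \<sigma> * g v" "v \<in> Y interior_of W"
              using W(1) openin_interior_of[of Y W] unfolding in_closure_of
              by (metis (no_types, lifting) mem_Collect_eq)
            have "connectedin Y {x\<in>W. 0 < \<sigma> * g x}"
              using W(2) \<sigma> by (auto simp: sign_piece_def)
            then have "connectedin (?Z g) {x\<in>W. 0 < \<sigma> * g x}"
              using connectedin_subset_topspace by (fastforce simp: connectedin_subtopology)
            then have "connected_component_of (?Z g) u v"
              unfolding connected_component_of_def using u v interior_of_subset[of Y W]
              by (intro exI[of _ "{x\<in>W. 0 < \<sigma> * g x}"]) auto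
            then show False
              using unlinked u v True by auto
          qed
        qed
        have "\<forall>\<^sub>F t in F. \<forall>x\<in>Q \<inter> R. sgn (f t x) = sgn (g x)"
          by (rule sgnK) (use Q neg in force)+
        then show ?thesis
        proof eventually_elim
          case (elim t)
          have "\<not> 0 < \<sigma> * f t x" if "x \<in> Q \<inter> R" for x
          proof -
            have "sgn (\<sigma> * f t x) = sgn (\<sigma> * g x)"
              using elim that by (simp add: sgn_mult)
            then show ?thesis
              using neg[OF that] by (metis less_asym sgn_less)
          qed
          then show ?case
            using True by auto
        qed
      next
        case False
        then have "\<tau> = - \<sigma>"
          using \<sigma> by auto
        then show ?thesis
          by (intro always_eventually) auto
      qed
    qed (intro always_eventually, blast)
  qed
  from E1 E2 E3 contf show ?thesis
  proof eventually_elim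
    case (elim t)
    have cov': "topspace (?Z h) \<subseteq> (\<Union>j\<in>J. ?V h j)" for h
    proof
      fix x assume "x \<in> topspace (?Z h)"
      then obtain Q where Q: "Q \<in> \<Q>" "x \<in> Q" "h x \<noteq> 0"
        using cov by auto
      have "x \<in> ?V h (Q, if 0 < h x then 1 else -1)"
        using Q by auto
      moreover have "(Q, if 0 < h x then 1 else -1) \<in> J"
        using Q by (auto simp: J_def)
      ultimately show "x \<in> (\<Union>j\<in>J. ?V h j)"
        by blast
    qed
    have closed': "closedin (?Z h) (?V h j)" if "j \<in> J" "continuous_map Y euclideanreal h" for j h
    proof -
      obtain Q \<sigma> where j: "j = (Q, \<sigma>)" "Q \<in> \<Q>"
        using \<open>j \<in> J\<close> by (auto simp: J_def)
      then show ?thesis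
        using closedin_positive_part[OF cl that(2)] by simp
    qed
    have conn': "connectedin (?Z h) (?V h j)" if "connectedin Y (?V h j)" for j h
    proof -
      have "?V h j \<subseteq> {x \<in> topspace Y. h x \<noteq> 0}"
        using connectedin_subset_topspace[OF that] by (auto split: prod.splits)
      then show ?thesis
        using that by (simp add: connectedin_subtopology)
    qed
    have V: "\<And>j. j \<in> J \<Longrightarrow> closedin (?Z g) (?V g j)" "\<And>j. j \<in> J \<Longrightarrow> connectedin (?Z g) (?V g j)"
      by (rule closed'[OF _ contg], assumption) (rule conn'[OF conn_g])
    have U: "\<And>j. j \<in> J \<Longrightarrow> closedin (?Z (f t)) (?V (f t) j)"
      "\<And>j. j \<in> J \<Longrightarrow> connectedin (?Z (f t)) (?V (f t) j)"
      by (rule closed'[OF _ elim(4)], assumption) (rule conn', use elim(1) in blast)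
    have persist: "\<And>i j. i \<in> J \<Longrightarrow> j \<in> J \<Longrightarrow> ?V g i \<inter> ?V g j \<noteq> {} \<Longrightarrow> ?V (f t) i \<inter> ?V (f t) j \<noteq> {}"
      using elim(2) by (meson)
    have linked: "\<And>i j. i \<in> J \<Longrightarrow> j \<in> J \<Longrightarrow> ?V (f t) i \<inter> ?V (f t) j \<noteq> {} \<Longrightarrow>
        \<exists>x\<in>?V g i. \<exists>y\<in>?V g j. connected_component_of (?Z g) x y"
      using elim(3) by (meson)
    note C = card_components_eq_by_covers[OF finJ V cov' U cov' persist linked]
    show ?case
      using C by simp
  qed
qed

section \<open>Components of a space and of a closed piece\<close>

lemma connected_component_of_set_eqI:
  assumes "connected_component_of X x y"
  shows "connected_component_of_set X x = connected_component_of_set X y"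
proof -
  have "connected_component_of X x = connected_component_of X y"
    using assms connected_component_of_equiv[of X x y] by blast
  then show ?thesis
    by simp
qed

lemma connected_component_of_set_eqD:
  assumes "connected_component_of_set X x = connected_component_of_set X y" "y \<in> topspace X"
  shows "connected_component_of X x y"
proof -
  have "y \<in> connected_component_of_set X y"
    using assms(2) by (simp add: connected_component_of_refl)
  then show ?thesis
    using assms(1) by blast
qed

lemma connected_component_ofI:
  "connectedin X K \<Longrightarrow> x \<in> K \<Longrightarrow> y \<in> K \<Longrightarrow> connected_component_of X x y"
  unfolding connected_component_of_def by blast

lemma connected_component_of_subtopology:
  "connectedin X (connected_component_of_set (subtopology X U) z)"
  "connected_component_of_set (subtopology X U) z \<subseteq> U"
  using connectedin_connected_component_of[of "subtopology X U" z]
  by (simp_all add: connectedin_subtopology)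

text \<open>The component is open by local connectedness. If its closure avoided \<open>P\<close>,
  the closure would be a connected subset of the complement, hence the component itself, and a
  clopen nonempty set would be the whole connected space.\<close>

lemma closure_of_complement_component_meets:
  assumes X: "connected_space X" "locally_connected_space X"
    and P: "closedin X P" "P \<noteq> {}" and z: "z \<in> topspace X - P"
  shows "X closure_of (connected_component_of_set (subtopology X (topspace X - P)) z) \<inter> P \<noteq> {}"
proof
  let ?U = "topspace X - P"
  let ?C = "connected_component_of_set (subtopology X ?U) z"
  assume disj: "X closure_of ?C \<inter> P = {}"
  have op: "openin X ?C"
    using locally_connected_B[OF X(2)] P(1) z by blast
  have C: "connectedin X ?C" "?C \<subseteq> ?U"
    by (rule connected_component_of_subtopology)+
  have zC: "z \<in> ?C"
    using z by (simp add: connected_component_of_refl)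
  have "connectedin (subtopology X ?U) (X closure_of ?C)"
    using connectedin_closure_of[OF C(1)] disj closure_of_subset_topspace[of X ?C]
    by (auto simp: connectedin_subtopology)
  then have "X closure_of ?C \<subseteq> ?C"
    by (rule connected_component_of_maximal)
      (use zC closure_of_subset[OF openin_subset[OF op]] in blast)
  then have "closedin X ?C"
    using closure_of_subset_eq openin_subset[OF op] by blast
  then have "?C = topspace X"
    using X(1) op zC unfolding connected_space_clopen_in by blast
  then show False
    using C(2) P closedin_subset by fastforce
qed

lemma closure_of_complement_Int_subset_frontier:
  assumes "C \<subseteq> topspace X - P" "closedin X P"
  shows "X closure_of C \<inter> P \<subseteq> X frontier_of P"
  using assms closure_of_mono[OF assms(1)]
  by (auto simp: frontier_of_closures closure_of_closedin)

text \<open>A component outside \<open>P\<close> has a closure point in \<open>P\<close>. This is a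
  frontier point, so it avoids \<open>N\<close>, and adding it to the component preserves
  connectedness.\<close>

lemma connected_component_meets_piece:
  assumes X: "connected_space X" "locally_connected_space X"
    and P: "closedin X P" "P \<noteq> {}" and N: "N \<subseteq> P" "X frontier_of P \<inter> N = {}"
    and x: "x \<in> topspace X - N"
  shows "\<exists>y\<in>P - N. connected_component_of (subtopology X (topspace X - N)) x y"
proof (cases "x \<in> P")
  case True
  then show ?thesis
    using x by (intro bexI[of _ x]) (auto simp: connected_component_of_refl)
next
  case False
  let ?C = "connected_component_of_set (subtopology X (topspace X - P)) x"
  have C: "connectedin X ?C" "?C \<subseteq> topspace X - P"
    by (rule connected_component_of_subtopology)+
  have xC: "x \<in> ?C"
    using x False by (simp add: connected_component_of_refl)
  obtain y where y: "y \<in> X closure_of ?C" "y \<in> P"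
    using closure_of_complement_component_meets[OF X P] x False by blast
  then have yN: "y \<notin> N"
    using closure_of_complement_Int_subset_frontier[OF C(2) P(1)] N by blast
  have "connectedin X (insert y ?C)"
    by (rule connectedin_intermediate_closure_of[OF C(1)])
      (use y closure_of_subset[OF connectedin_subset_topspace[OF C(1)]] in auto)
  moreover have "insert y ?C \<subseteq> topspace X - N"
    using yN y P(1) closedin_subset C(2) N by fastforce
  ultimately have "connectedin (subtopology X (topspace X - N)) (insert y ?C)"
    by (simp add: connectedin_subtopology)
  then have "connected_component_of (subtopology X (topspace X - N)) x y"
    by (rule connected_component_ofI) (use xC in auto)
  then show ?thesis
    using y yN by blast
qed

text \<open>All components are thereby represented by points of \<open>P - N\<close>, the same
  representatives as for the piece.\<close>

lemma connected_components_of_conv_piece: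
  assumes X: "connected_space X" "locally_connected_space X"
    and P: "closedin X P" "P \<noteq> {}" and N: "N \<subseteq> P" "X frontier_of P \<inter> N = {}"
  shows "connected_components_of (subtopology X (topspace X - N)) =
    connected_component_of_set (subtopology X (topspace X - N)) ` (P - N)"
proof
  show "connected_components_of (subtopology X (topspace X - N)) \<subseteq>
    connected_component_of_set (subtopology X (topspace X - N)) ` (P - N)"
  proof
    fix K assume "K \<in> connected_components_of (subtopology X (topspace X - N))"
    then obtain x where x: "x \<in> topspace X - N"
      "K = connected_component_of_set (subtopology X (topspace X - N)) x"
      by (auto simp: connected_components_of_def)
    then obtain y where "y \<in> P - N" "connected_component_of (subtopology X (topspace X - N)) x y"
      using connected_component_meets_piece[OF X P N] by blast
    then show "K \<in> connected_component_of_set (subtopology X (topspace X - N)) ` (P - N)"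
      unfolding x(2) by (auto intro!: image_eqI connected_component_of_set_eqI)
  qed
  show "connected_component_of_set (subtopology X (topspace X - N)) ` (P - N) \<subseteq>
      connected_components_of (subtopology X (topspace X - N))"
    using closedin_subset[OF P(1)] by (auto simp: connected_components_of_def)
qed

text \<open>Points connected in \<open>P - N\<close> are connected in the larger set, so its
  components are the image of those of the piece under a well-defined map. Finiteness is assumed
  because \<open>card\<close> is 0 on infinite sets.\<close>

lemma card_components_le_piece:
  assumes X: "connected_space X" "locally_connected_space X"
    and P: "closedin X P" "P \<noteq> {}" and N: "N \<subseteq> P" "X frontier_of P \<inter> N = {}"
    and fin: "finite (connected_components_of (subtopology X (P - N)))"
  shows "card (connected_components_of (subtopology X (topspace X - N)))
    \<le> card (connected_components_of (subtopology X (P - N)))"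
proof -
  let ?K = "connected_component_of_set (subtopology X (topspace X - N))"
  let ?V = "connected_component_of_set (subtopology X (P - N))"
  have PX: "P - N \<subseteq> topspace X - N"
    using closedin_subset[OF P(1)] by blast
  have V: "connected_components_of (subtopology X (P - N)) = ?V ` (P - N)"
    using PX by (auto simp: connected_components_of_def Int_absorb1 topspace_subtopology_subset)
  have *: "?K x = ?K y" if "x \<in> P - N" "y \<in> P - N" "?V x = ?V y" for x y
  proof -
    have "connected_component_of (subtopology X (P - N)) x y"
      by (rule connected_component_of_set_eqD[OF that(3)]) (use that PX in auto)
    then have "connected_component_of (subtopology X (topspace X - N)) x y"
      by (rule connected_component_of_mono) (rule PX)
    then show ?thesis
      by (rule connected_component_of_set_eqI)
  qed
  have "?K ` (P - N) = (\<lambda>v. ?K (SOME x. x \<in> P - N \<and> ?V x = v)) ` (?V ` (P - N))"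
    unfolding image_image
  proof (rule image_cong)
    fix x assume x: "x \<in> P - N"
    have "(SOME y. y \<in> P - N \<and> ?V y = ?V x) \<in> P - N \<and> ?V (SOME y. y \<in> P - N \<and> ?V y = ?V x) = ?V x"
      by (rule someI[of "\<lambda>y. y \<in> P - N \<and> ?V y = ?V x"]) (use x in blast)
    then show "?K x = ?K (SOME y. y \<in> P - N \<and> ?V y = ?V x)"
      by (intro *[OF x]) simp_all
  qed simp
  then show ?thesis
    unfolding connected_components_of_conv_piece[OF X P N] V
    by (simp only:) (rule card_image_le, use fin V in simp)
qed

text \<open>A component \<open>V\<close> of the piece, enlarged by the complementary components attached to it, is
  clopen: the enlargements are open and, as every complementary component is attached to exactly
  one \<open>V\<close>, they partition the space.\<close>

lemma card_components_eq_piece: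
  assumes X: "connected_space X" "locally_connected_space X"
    and P: "closedin X P" "P \<noteq> {}" and N: "N \<subseteq> P" "closedin X N"
    and B: "X frontier_of P \<subseteq> \<Union>\<B>" "\<Union>\<B> \<subseteq> P - N" "\<And>B. B \<in> \<B> \<Longrightarrow> connectedin X B"
    and one: "complement_components_meet_at_most_one X P \<B>"
    and fin: "finite (connected_components_of (subtopology X (P - N)))"
  shows "card (connected_components_of (subtopology X (topspace X - N)))
    = card (connected_components_of (subtopology X (P - N)))"
proof -
  let ?Y = "subtopology X (topspace X - N)"
  let ?Z = "subtopology X (P - N)"
  let ?K = "connected_component_of_set ?Y"
  let ?V = "connected_component_of_set ?Z"
  let ?C = "connected_component_of_set (subtopology X (topspace X - P))"
  have frN: "X frontier_of P \<inter> N = {}"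
    using B by blast
  have PX: "P - N \<subseteq> topspace X - N" "P \<subseteq> topspace X"
    using closedin_subset[OF P(1)] by blast+
  have tZ: "topspace ?Z = P - N"
    using PX by auto
  have V: "connected_components_of ?Z = ?V ` (P - N)"
    unfolding connected_components_of_def tZ ..
  define W where "W = (\<lambda>v. ?V v \<union> {z \<in> topspace X - P. X closure_of (?C z) \<inter> ?V v \<noteq> {}})"
  have Vsub: "?V v \<subseteq> P - N" for v
    using connected_component_of_subset_topspace[of ?Z v] tZ by blast
  have Csub: "?C z \<subseteq> topspace X - P" for z
    using connected_component_of_subset_topspace[of "subtopology X (topspace X - P)" z] by auto
  have opC: "openin X (?C z)" for z
  proof (cases "z \<in> topspace X - P")
    case True
    then show ?thesis
      using locally_connected_B[OF X(2)] P(1) by blast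
  next
    case False
    then have "?C z = {}"
      by (subst connected_component_of_eq_empty) auto
    then show ?thesis
      by (simp only: openin_empty)
  qed
  have eqC: "?C w = ?C z" if "w \<in> ?C z" for w z
    using connected_component_of_set_eqI[of _ z w] that by simp
  \<comment> \<open>Components are relatively closed: the closure of \<open>?C z\<close> gains only
    points of \<open>P\<close>.\<close>
  have closC: "X closure_of (?C z) \<inter> (topspace X - P) \<subseteq> ?C z" for z
  proof -
    have "(subtopology X (topspace X - P)) closure_of (?C z) = ?C z"
      by (rule closure_of_closedin) (rule closedin_connected_component_of)
    then show ?thesis
      using Csub[of z] by (simp add: closure_of_subtopology Int_absorb1 Int_commute)
  qed
  have opW: "openin ?Y (W v)" if v: "v \<in> P - N" for v
  proof -
    \<comment> \<open>The complement of one component is the union of the others, closed because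
      they are finitely many.\<close>
    have "openin ?Z (?V v)"
    proof -
      have "?V v \<in> connected_components_of ?Z"
        using v V by blast
      then have "topspace ?Z - ?V v = \<Union>(connected_components_of ?Z - {?V v})"
        using complement_connected_components_of_Union[where C = "?V v" and X = ?Z] by simp
      moreover have "closedin ?Z (\<Union>(connected_components_of ?Z - {?V v}))"
        using fin closedin_connected_components_of by (intro closedin_Union) auto
      ultimately show ?thesis
        using connected_component_of_subset_topspace[of ?Z v] by (simp add: openin_closedin_eq)
    qed
    then obtain G where G: "openin X G" "?V v = G \<inter> (P - N)"
      unfolding openin_subtopology by blast
    have "\<exists>H. openin X H \<and> x \<in> H \<and> H \<subseteq> W v" if x: "x \<in> W v" for x
    proof (cases "x \<in> P")
      case True
      then have xV: "x \<in> ?V v"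
        using x by (auto simp: W_def)
      then have "openin X (G - N)" "x \<in> G - N"
        using G N by auto
      then obtain H where H: "openin X H" "connectedin X H" "x \<in> H" "H \<subseteq> G - N"
        using X(2) unfolding locally_connected_space by meson
      have "H \<subseteq> W v"
      proof
        fix w assume w: "w \<in> H"
        show "w \<in> W v"
        proof (cases "w \<in> P")
          case True
          then show ?thesis
            using w H G by (auto simp: W_def)
        next
          case False
          have wX: "w \<in> topspace X - P"
            using False w openin_subset[OF H(1)] by blast
          \<comment> \<open>Otherwise \<open>H \<inter> ?C w\<close> would be clopen in the
            connected set \<open>H\<close>, although it contains \<open>w\<close> and misses
            \<open>x\<close>. Inside \<open>H\<close> all points of \<open>P\<close> belong to
            \<open>?V v\<close>, so the closure of \<open>?C w\<close> meets \<open>?V v\<close>, as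
            membership of \<open>w\<close> in \<open>W v\<close> demands.\<close>
          have "X closure_of (?C w) \<inter> H \<inter> P \<noteq> {}"
          proof
            assume e: "X closure_of (?C w) \<inter> H \<inter> P = {}"
            have "H \<inter> X closure_of (?C w) \<subseteq> ?C w"
              using closC[of w] e openin_subset[OF H(1)] by blast
            then have eq: "H \<inter> X closure_of (?C w) = H \<inter> ?C w"
              using closure_of_subset[OF openin_subset[OF opC]] by blast
            have "openin (subtopology X H) (H \<inter> ?C w)"
              using opC by (simp add: openin_subtopology_Int2)
            moreover have "closedin (subtopology X H) (H \<inter> ?C w)"
              using eq closedin_closure_of[of X "?C w"] closedin_subtopology by blast
            ultimately have "H \<inter> ?C w = {} \<or> H \<inter> ?C w = H"
              using H(2) openin_subset[OF H(1)]
              by (metis connectedin_def connected_space_clopen_in topspace_subtopology_subset)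
            moreover have "w \<in> H \<inter> ?C w"
              using w wX by (auto simp: connected_component_of_refl)
            moreover have "x \<notin> ?C w"
              using Csub[of w] \<open>x \<in> P\<close> by blast
            ultimately show False
              using H(3) by blast
          qed
          then have "X closure_of (?C w) \<inter> ?V v \<noteq> {}"
            using H(4) G by blast
          then show ?thesis
            using wX by (auto simp: W_def)
        qed
      qed
      then show ?thesis
        using H by blast
    next
      case False
      then have "x \<in> topspace X - P" "X closure_of (?C x) \<inter> ?V v \<noteq> {}"
        using x Vsub[of v] by (auto simp: W_def)
      then have "?C x \<subseteq> W v" "x \<in> ?C x"
        unfolding W_def using eqC Csub[of x] by (auto simp: connected_component_of_refl)
      then show ?thesis
        using opC by blast
    qed
    then have "openin X (W v)"
      by (subst openin_subopen) blast
    moreover have "W v \<subseteq> topspace X - N"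
      unfolding W_def using Vsub[of v] PX N by blast
    ultimately show ?thesis
      by (simp add: openin_subset_topspace_eq openin_open_subtopology N(2) openin_diff)
  qed
  \<comment> \<open>The hypothesis \<open>one\<close> enters here. If the closure of
    \<open>?C z\<close> touches \<open>?V u\<close> at \<open>a\<close> and \<open>?V v\<close> at
    \<open>b\<close>, both are frontier points and hence lie in members of \<open>\<B>\<close>,
    which must be equal; this member is a connected subset of \<open>P - N\<close> and joins
    \<open>a\<close> to \<open>b\<close>.\<close>
  have disj: "?V u = ?V v" if "u \<in> P - N" "v \<in> P - N" "z \<in> W u" "z \<in> W v" for u v z
  proof -
    have meet: "?V u = ?V v" if "x \<in> ?V u" "x \<in> ?V v" for x
      using connected_component_of_set_eqI[of ?Z _ x] that by simp
    show ?thesis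
    proof (cases "z \<in> P")
      case True
      then have "z \<in> ?V u" "z \<in> ?V v"
        using that(3,4) unfolding W_def by blast+
      then show ?thesis
        by (rule meet)
    next
      case False
      then have "X closure_of (?C z) \<inter> ?V u \<noteq> {}" "X closure_of (?C z) \<inter> ?V v \<noteq> {}"
        and z: "z \<in> topspace X - P"
        using that Vsub by (auto simp: W_def)
      then obtain a b where a: "a \<in> X closure_of (?C z)" "a \<in> ?V u"
        and b: "b \<in> X closure_of (?C z)" "b \<in> ?V v"
        by blast
      have "a \<in> \<Union>\<B>" "b \<in> \<Union>\<B>"
        using closure_of_complement_Int_subset_frontier[OF Csub P(1)] B(1) a b Vsub by blast+
      then obtain A B where AB: "A \<in> \<B>" "B \<in> \<B>" "a \<in> A" "b \<in> B"
        by blast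
      have "?C z \<in> connected_components_of (subtopology X (topspace X - P))"
        using z by (simp add: connected_component_in_connected_components_of)
      then have "A = B"
        using one AB a b unfolding complement_components_meet_at_most_one_def by blast
      moreover have "connectedin ?Z B"
        using B AB by (auto simp: connectedin_subtopology)
      ultimately have "connected_component_of ?Z a b"
        using connected_component_ofI[of ?Z B a b] AB by blast
      then have "?V a = ?V b"
        by (rule connected_component_of_set_eqI)
      moreover have "?V u = ?V a" "?V v = ?V b"
        using a b connected_component_of_set_eqI[of ?Z] by simp_all
      ultimately show ?thesis
        by simp
    qed
  qed
  have cover: "\<exists>v\<in>P - N. z \<in> W v" if z: "z \<in> topspace X - N" for z
  proof (cases "z \<in> P")
    case True
    then have "z \<in> W z"
      using z tZ by (auto simp: W_def connected_component_of_refl)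
    then show ?thesis
      using True z by blast
  next
    case False
    then obtain v where v: "v \<in> X closure_of (?C z)" "v \<in> P"
      using closure_of_complement_component_meets[OF X P] z by blast
    then have "v \<in> P - N"
      using closure_of_complement_Int_subset_frontier[OF Csub P(1)] frN by blast
    moreover have "v \<in> ?V v"
      using calculation tZ by (auto simp: connected_component_of_refl)
    ultimately show ?thesis
      using False z v by (auto simp: W_def)
  qed
  have sep: "?V x = ?V y" if xy: "x \<in> P - N" "y \<in> P - N" "connected_component_of ?Y x y" for x y
  proof -
    \<comment> \<open>\<open>W v\<close> depends only on the component \<open>?V v\<close>. So
      \<open>W x\<close> and the union of the sets \<open>W v\<close> for the other components are
      disjoint, open and cover the space, and a connected set through \<open>x\<close> cannot leave
      \<open>W x\<close>.\<close>
    let ?G = "\<Union>v\<in>{v \<in> P - N. ?V v \<noteq> ?V x}. W v"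
    have G: "openin ?Y ?G"
      using opW by blast
    have WG: "W x \<inter> ?G = {}"
      using disj xy(1) by blast
    have un: "topspace ?Y \<subseteq> W x \<union> ?G"
    proof
      fix z assume "z \<in> topspace ?Y"
      then obtain v where v: "v \<in> P - N" "z \<in> W v"
        using cover by auto
      show "z \<in> W x \<union> ?G"
      proof (cases "?V v = ?V x")
        case True
        then have "W v = W x"
          unfolding W_def by (simp only:)
        then show ?thesis
          using v by blast
      qed (use v in blast)
    qed
    obtain L where L: "connectedin ?Y L" "x \<in> L" "y \<in> L"
      using xy(3) by (auto simp: connected_component_of_def)
    have W: "x \<in> W x" "y \<in> W y"
      using xy tZ by (auto simp: W_def connected_component_of_refl)
    have "L \<subseteq> W x \<union> ?G"
      using un connectedin_subset_topspace[OF L(1)] by (rule order_trans[rotated])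
    moreover have "W x \<inter> ?G \<inter> L = {}" "W x \<inter> L \<noteq> {}"
      using WG W(1) L(2) by blast+
    ultimately have "?G \<inter> L = {}"
      using connectedinD[OF L(1) opW[OF xy(1)] G] by metis
    then have "?V y = ?V x"
      using W(2) L(3) xy(2) by blast
    then show ?thesis ..
  qed
  show ?thesis
    unfolding connected_components_of_conv_piece[OF X P N(1) frN] V
  proof (rule card_image_eq_if_same_kernel)
    fix x y assume xy: "x \<in> P - N" "y \<in> P - N"
    show "?K x = ?K y \<longleftrightarrow> ?V x = ?V y"
    proof
      assume "?K x = ?K y"
      then have "connected_component_of ?Y x y"
        by (rule connected_component_of_set_eqD) (use xy PX in auto)
      then show "?V x = ?V y"
        using sep xy by blast
    next
      assume "?V x = ?V y"
      then have "connected_component_of ?Z x y"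
        by (rule connected_component_of_set_eqD) (use xy tZ in auto)
      then have "connected_component_of ?Y x y"
        by (rule connected_component_of_mono) (rule PX(1))
      then show "?K x = ?K y"
        by (rule connected_component_of_set_eqI)
    qed
  qed
qed

section \<open>Transversal zeros in Euclidean space\<close>

text \<open>For a unit vector \<open>v\<close>, the solid cylinder with centre \<open>z\<close>,
  axis direction \<open>v\<close>, half-height \<open>a\<close> and radius \<open>b\<close>; in the
  plane, a rectangle. Splitting off the component along \<open>v\<close> avoids choosing coordinates
  on its complement.\<close>

definition cyl :: "'a::real_inner \<Rightarrow> 'a \<Rightarrow> real \<Rightarrow> real \<Rightarrow> 'a set" where
  "cyl z v a b = {x. \<bar>(x - z) \<bullet> v\<bar> \<le> a \<and> norm (x - z - ((x - z) \<bullet> v) *\<^sub>R v) \<le> b}"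

text \<open>Every line parallel to the axis carries exactly one zero in the cylinder, so the zero
  set is a graph over the cross-section. The formulation by strict inequalities is chosen for its
  stability under \<open>C^1\<close> convergence.\<close>

definition crosses :: "'a::real_inner \<Rightarrow> 'a \<Rightarrow> real \<Rightarrow> real \<Rightarrow> ('a \<Rightarrow> real) \<Rightarrow> bool" where
  "crosses z v a b h \<longleftrightarrow>
     (\<forall>x\<in>cyl z v a b. \<exists>h'. (h has_derivative h') (at x) \<and> 0 < h' v) \<and>
     (\<forall>x\<in>cyl z v a b. (x - z) \<bullet> v = a \<longrightarrow> 0 < h x) \<and>
     (\<forall>x\<in>cyl z v a b. (x - z) \<bullet> v = - a \<longrightarrow> h x < 0)"

lemma cyl_uminus: "cyl z (- v) a b = cyl z v a b"
  by (simp add: cyl_def)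

text \<open>Reversing the axis along with the sign turns statements on the positive part into
  statements on the negative part.\<close>

lemma crosses_uminus:
  assumes "crosses z v a b h"
  shows "crosses z (- v) a b (\<lambda>x. - h x)"
  unfolding crosses_def cyl_uminus
proof (intro conjI ballI impI)
  fix x assume x: "x \<in> cyl z v a b"
  then obtain h' where h': "(h has_derivative h') (at x)" "0 < h' v"
    using assms by (auto simp: crosses_def)
  then have "linear h'"
    using has_derivative_linear by blast
  then have "((\<lambda>x. - h x) has_derivative (\<lambda>x. - h' x)) (at x)" "0 < - h' (- v)"
    using h' by (auto intro: has_derivative_minus simp: linear_neg)
  then show "\<exists>h'. ((\<lambda>x. - h x) has_derivative h') (at x) \<and> 0 < h' (- v)"
    by blast
qed (use assms in \<open>auto simp: crosses_def\<close>)

text \<open>Moving along the axis changes the height by \<open>r\<close> and leaves the radial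
  component unchanged.\<close>

lemma cyl_translate:
  assumes "norm v = 1" "x \<in> cyl z v a b"
  shows "x + r *\<^sub>R v \<in> cyl z v a b \<longleftrightarrow> \<bar>(x - z) \<bullet> v + r\<bar> \<le> a"
proof -
  have 1: "(x + r *\<^sub>R v - z) \<bullet> v = (x - z) \<bullet> v + r"
    using assms(1) by (simp add: inner_diff_left inner_add_left dot_square_norm)
  have 2: "x + r *\<^sub>R v - z - ((x - z) \<bullet> v + r) *\<^sub>R v = x - z - ((x - z) \<bullet> v) *\<^sub>R v"
    by (simp add: algebra_simps)
  show ?thesis
    using assms(2) unfolding cyl_def mem_Collect_eq 1 2 by simp
qed

lemma convex_cyl: "convex (cyl z v a b)"
proof -
  let ?S = "(\<lambda>y. y \<bullet> v) -` {-a..a} \<inter> (\<lambda>y. y - (y \<bullet> v) *\<^sub>R v) -` cball 0 b"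
  have mem: "x \<in> cyl z v a b \<longleftrightarrow> x - z \<in> ?S" for x
    by (auto simp: cyl_def)
  have eq: "cyl z v a b = (+) z ` ?S"
  proof (intro set_eqI iffI)
    fix x assume "x \<in> cyl z v a b"
    then show "x \<in> (+) z ` ?S"
      unfolding mem by (rule rev_image_eqI) simp
  next
    fix x assume "x \<in> (+) z ` ?S"
    then obtain y where "y \<in> ?S" "x = z + y"
      by blast
    then show "x \<in> cyl z v a b"
      unfolding mem by (simp only: add_diff_cancel_left')
  qed
  show ?thesis
    unfolding eq
    by (intro convex_translation convex_Int convex_linear_vimage linearI)
       (auto simp: algebra_simps inner_add_left)
qed

lemma closed_cyl: "closed (cyl z v a b)"
  unfolding cyl_def by (intro closed_Collect_conj closed_Collect_le continuous_intros)

lemma cyl_subset_cball: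
  assumes "norm v = 1"
  shows "cyl z v a b \<subseteq> cball z (a + b)"
proof
  fix x assume "x \<in> cyl z v a b"
  then have "\<bar>(x - z) \<bullet> v\<bar> \<le> a" "norm (x - z - ((x - z) \<bullet> v) *\<^sub>R v) \<le> b"
    by (auto simp: cyl_def)
  moreover have "norm (x - z) \<le> norm (x - z - ((x - z) \<bullet> v) *\<^sub>R v) + norm (((x - z) \<bullet> v) *\<^sub>R v)"
    using norm_triangle_ineq[of "x - z - ((x - z) \<bullet> v) *\<^sub>R v" "((x - z) \<bullet> v) *\<^sub>R v"] by simp
  ultimately show "x \<in> cball z (a + b)"
    using assms by (simp add: dist_norm norm_minus_commute)
qed

lemma compact_cyl:
  fixes z :: "'a::euclidean_space"
  assumes "norm v = 1"
  shows "compact (cyl z v a b)"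
  using closed_cyl bounded_subset[OF bounded_cball cyl_subset_cball[OF assms]]
  by (simp add: compact_eq_bounded_closed)

text \<open>The triangle inequality bounds the radial component by twice the distance to
  \<open>z\<close>, whence the radius \<open>b / 2\<close>.\<close>

lemma ball_subset_cyl:
  assumes "norm v = 1"
  shows "ball z (min a (b / 2)) \<subseteq> cyl z v a b"
proof
  fix x assume x: "x \<in> ball z (min a (b / 2))"
  then have n: "norm (x - z) < a" "norm (x - z) < b / 2"
    by (auto simp: dist_norm norm_minus_commute)
  have i: "\<bar>(x - z) \<bullet> v\<bar> \<le> norm (x - z)"
    using Cauchy_Schwarz_ineq2[of "x - z" v] assms by simp
  have "norm (x - z - ((x - z) \<bullet> v) *\<^sub>R v) \<le> norm (x - z) + \<bar>(x - z) \<bullet> v\<bar>"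
    using norm_triangle_ineq4[of "x - z" "((x - z) \<bullet> v) *\<^sub>R v"] assms by simp
  then show "x \<in> cyl z v a b"
    using n i by (auto simp: cyl_def)
qed

lemma has_real_derivative_along_line:
  assumes "(h has_derivative h') (at (x + r *\<^sub>R v))"
  shows "((\<lambda>r. h (x + r *\<^sub>R v)) has_real_derivative h' v) (at r)"
proof -
  have "((\<lambda>r. h (x + r *\<^sub>R v)) has_derivative (\<lambda>y. h' (y *\<^sub>R v))) (at r)"
    by (rule has_derivative_compose[where f = "\<lambda>r. x + r *\<^sub>R v" and g = h])
       (auto intro!: derivative_eq_intros assms)
  moreover have "(\<lambda>y. h' (y *\<^sub>R v)) = (*) (h' v)"
    using has_derivative_linear[OF assms] by (auto simp: linear_scale mult.commute)
  ultimately show ?thesis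
    by (simp add: has_field_derivative_def)
qed

lemma crosses_increasing:
  assumes v: "norm v = 1" and h: "crosses z v a b h"
    and x: "x \<in> cyl z v a b" and s: "0 < s" "(x - z) \<bullet> v + s \<le> a"
  shows "h x < h (x + s *\<^sub>R v)"
proof -
  have "h (x + 0 *\<^sub>R v) < h (x + s *\<^sub>R v)"
  proof (rule DERIV_pos_imp_increasing[OF s(1)])
    fix r assume r: "0 \<le> r" "r \<le> s"
    have "\<bar>(x - z) \<bullet> v + r\<bar> \<le> a"
      using x r s by (auto simp: cyl_def)
    then have "x + r *\<^sub>R v \<in> cyl z v a b"
      using cyl_translate[OF v x] by blast
    then obtain h' where h': "(h has_derivative h') (at (x + r *\<^sub>R v))" "0 < h' v"
      using h by (auto simp: crosses_def)
    then show "\<exists>y. ((\<lambda>r. h (x + r *\<^sub>R v)) has_real_derivative y) (at r) \<and> 0 < y"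
      using has_real_derivative_along_line by blast
  qed
  then show ?thesis
    by simp
qed

text \<open>Every point where \<open>h\<close> is positive is joined to the face \<open>(x - z) \<bullet> v = a\<close> along \<open>v\<close>.\<close>

lemma connected_positive_if_crosses:
  assumes v: "norm v = 1" and h: "crosses z v a b h"
  shows "connected {x\<in>cyl z v a b. 0 < h x}"
proof -
  let ?P = "{x\<in>cyl z v a b. 0 < h x}"
  let ?E = "{x\<in>cyl z v a b. (x - z) \<bullet> v = a}"
  \<comment> \<open>The point above \<open>x\<close> on the top face, reached by moving along
    \<open>v\<close>.\<close>
  define e where "e = (\<lambda>x. x + (a - (x - z) \<bullet> v) *\<^sub>R v)"
  have "?E = cyl z v a b \<inter> {x. v \<bullet> x = a + z \<bullet> v}"
    by (auto simp: inner_diff_left inner_diff_right inner_commute)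
  then have cE: "connected ?E"
    by (metis convex_Int convex_cyl convex_connected convex_hyperplane)
  have EP: "?E \<subseteq> ?P"
    using h by (auto simp: crosses_def)
  have e: "e x \<in> ?E" if "x \<in> cyl z v a b" for x
  proof -
    have "0 \<le> a"
      using that by (auto simp: cyl_def)
    then have "e x \<in> cyl z v a b"
      unfolding e_def using cyl_translate[OF v that] by simp
    moreover have "(e x - z) \<bullet> v = a"
      using v by (simp add: e_def inner_diff_left inner_add_left dot_square_norm)
    ultimately show ?thesis
      by blast
  qed
  have seg: "closed_segment x (e x) \<subseteq> ?P" if x: "x \<in> ?P" for x
  proof
    fix y assume "y \<in> closed_segment x (e x)"
    then obtain u where u: "0 \<le> u" "u \<le> 1" "y = (1 - u) *\<^sub>R x + u *\<^sub>R e x"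
      by (auto simp: in_segment)
    define s where "s = u * (a - (x - z) \<bullet> v)"
    have y: "y = x + s *\<^sub>R v"
      unfolding u(3) e_def s_def by (simp add: algebra_simps)
    have c: "0 \<le> a - (x - z) \<bullet> v"
      using x by (auto simp: cyl_def)
    have "s \<le> 1 * (a - (x - z) \<bullet> v)"
      unfolding s_def using c u by (intro mult_right_mono) auto
    then have s: "0 \<le> s" "(x - z) \<bullet> v + s \<le> a"
      using u c by (auto simp: s_def)
    have "y \<in> cyl z v a b"
      unfolding y using cyl_translate[OF v, of x z a b s] x s by (auto simp: cyl_def)
    moreover have "0 < h y"
      using crosses_increasing[OF v h _ _ s(2)] x s y by (cases "s = 0") fastforce+
    ultimately show "y \<in> ?P"
      by blast
  qed
  \<comment> \<open>A union of connected sets that all contain the top face; the face is convex, and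
    each segment ends in it.\<close>
  have eq: "?P = (\<Union>x\<in>?P. ?E \<union> closed_segment x (e x))"
    using seg EP by blast
  have conn: "connected (?E \<union> closed_segment x (e x))" if "x \<in> ?P" for x
    using cE connected_segment e[of x] that by (intro connected_Un) auto
  show ?thesis
  proof (cases "?P = {}")
    case False
    then obtain x where "x \<in> ?P"
      by blast
    then have "(\<Inter>x\<in>?P. ?E \<union> closed_segment x (e x)) \<noteq> {}"
      using e[of x] by blast
    then show ?thesis
      by (subst eq, intro connected_Union) (use conn in auto)
  qed (simp only: connected_empty)
qed

text \<open>A zero does not lie on the top face, so it can be moved slightly along \<open>v\<close>,
  where \<open>h\<close> increases.\<close>

lemma zero_in_closure_positive_if_crosses:
  assumes v: "norm v = 1" and h: "crosses z v a b h" and x: "x \<in> cyl z v a b" "h x = 0"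
  shows "x \<in> closure {x\<in>cyl z v a b. 0 < h x}"
proof -
  let ?c = "(x - z) \<bullet> v"
  have c: "\<bar>?c\<bar> \<le> a" "?c \<noteq> a"
    using x h by (auto simp: crosses_def cyl_def)
  show ?thesis
    unfolding closure_approachable
  proof (intro allI impI)
    fix \<epsilon> :: real assume "0 < \<epsilon>"
    define s where "s = min (\<epsilon> / 2) (a - ?c)"
    have s: "0 < s" "s < \<epsilon>" "?c + s \<le> a"
      using \<open>0 < \<epsilon>\<close> c by (auto simp: s_def)
    have "x + s *\<^sub>R v \<in> cyl z v a b"
      using cyl_translate[OF v x(1)] s c by auto
    moreover have "0 < h (x + s *\<^sub>R v)"
      using crosses_increasing[OF v h x(1) s(1,3)] x(2) by simp
    moreover have "dist (x + s *\<^sub>R v) x < \<epsilon>"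
      using s v by (simp add: dist_norm)
    ultimately show "\<exists>y\<in>{x \<in> cyl z v a b. 0 < h x}. dist y x < \<epsilon>"
      by blast
  qed
qed

text \<open>The height is chosen on the axis alone: where the derivative along \<open>v\<close> is
  positive, \<open>g\<close> has opposite signs at the two end points. Only afterwards is the radius
  made small enough for these signs to hold on the entire faces.\<close>

lemma crosses_exists:
  fixes g :: "'a::euclidean_space \<Rightarrow> real"
  assumes W: "open W" "z \<in> W" and v: "norm v = 1"
    and g': "\<And>x. x \<in> W \<Longrightarrow> (g has_derivative g' x) (at x)"
    and cont: "continuous_on W (\<lambda>x. g' x v)" and z: "g z = 0" "0 < g' z v"
  obtains a b where "0 < a" "0 < b" "cyl z v a b \<subseteq> W" "crosses z v a b g"
proof -
  have "open {x\<in>W. g' x v \<in> {0<..}}"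
    using continuous_open_preimage[OF cont W(1), of "{0<..}"] by (simp add: vimage_def Int_def)
  then obtain r where r: "0 < r" "ball z r \<subseteq> {x\<in>W. g' x v \<in> {0<..}}"
    using W z by (auto elim!: openE)
  define a where "a = r / 2"
  have a: "0 < a"
    using r by (simp add: a_def)
  \<comment> \<open>The degenerate cylinder of radius 0, that is, the axis segment.\<close>
  have c0: "crosses z v a 0 g"
  proof -
    have sub: "cyl z v a 0 \<subseteq> ball z r"
      using cyl_subset_cball[OF v, of z a 0] r by (auto simp: a_def)
    have line: "x = z + ((x - z) \<bullet> v) *\<^sub>R v" if "x \<in> cyl z v a 0" for x
      using that by (simp add: cyl_def algebra_simps)
    have inc: "g (z + s *\<^sub>R v) < g (z + t *\<^sub>R v)" if st: "s < t" "- a \<le> s" "t \<le> a" for s t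
    proof (rule DERIV_pos_imp_increasing[OF st(1)])
      fix q assume q: "s \<le> q" "q \<le> t"
      have "z + q *\<^sub>R v \<in> ball z r"
        using q st r v by (simp add: dist_norm a_def abs_if)
      then have w: "z + q *\<^sub>R v \<in> W" "0 < g' (z + q *\<^sub>R v) v"
        using r by auto
      then show "\<exists>y. ((\<lambda>r. g (z + r *\<^sub>R v)) has_real_derivative y) (at q) \<and> 0 < y"
        using has_real_derivative_along_line[OF g'] by blast
    qed
    have ends: "0 < g (z + a *\<^sub>R v)" "g (z + (- a) *\<^sub>R v) < 0"
      using inc[of 0 a] inc[of "- a" 0] a z by auto
    show ?thesis
      unfolding crosses_def
    proof (intro conjI ballI impI)
      fix x assume x: "x \<in> cyl z v a 0"
      then have "x \<in> W" "0 < g' x v"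
        using sub r(2) by auto
      then show "\<exists>h'. (g has_derivative h') (at x) \<and> 0 < h' v"
        using g' by blast
      show "0 < g x" if "(x - z) \<bullet> v = a"
        using line[OF x] ends(1) unfolding that by simp
      show "g x < 0" if "(x - z) \<bullet> v = - a"
        using line[OF x] ends(2) unfolding that by simp
    qed
  qed
  define U where "U = {x\<in>W. g x \<in> {0<..}}"
  define L where "L = {x\<in>W. g x \<in> {..<0}}"
  have "continuous_on W g"
    using g' by (auto intro!: continuous_at_imp_continuous_on has_derivative_continuous)
  then have "open U" "open L"
    using continuous_open_preimage[OF _ W(1), of g "{0<..}"]
      continuous_open_preimage[OF _ W(1), of g "{..<0}"]
    by (simp_all add: U_def L_def vimage_def Int_def)
  moreover have "z + a *\<^sub>R v \<in> U" "z + (- a) *\<^sub>R v \<in> L"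
  proof -
    have m: "z + q *\<^sub>R v \<in> cyl z v a 0" "(z + q *\<^sub>R v - z) \<bullet> v = q" if "\<bar>q\<bar> \<le> a" for q
      using that v by (auto simp: cyl_def dot_square_norm)
    have "cyl z v a 0 \<subseteq> W"
      using cyl_subset_cball[OF v, of z a 0] r by (force simp: a_def)
    then show "z + a *\<^sub>R v \<in> U" "z + (- a) *\<^sub>R v \<in> L"
      using c0 m[of a] m[of "- a"] a unfolding crosses_def U_def L_def by fastforce+
  qed
  ultimately obtain d e where d: "0 < d" "ball (z + a *\<^sub>R v) d \<subseteq> U"
    and e: "0 < e" "ball (z + (- a) *\<^sub>R v) e \<subseteq> L"
    by (metis openE)
  \<comment> \<open>The bound \<open>r / 4\<close> keeps \<open>a + b\<close> below
    \<open>r\<close>; the bounds \<open>d / 2\<close> and \<open>e / 2\<close> keep the top face in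
    the ball inside \<open>U\<close> and the bottom face in the ball inside
    \<open>L\<close>.\<close>
  define b where "b = Min {r / 4, d / 2, e / 2}"
  have b: "0 < b" "b < r / 2" "b < d" "b < e"
    using r d e by (auto simp: b_def)
  have sub: "cyl z v a b \<subseteq> ball z r"
    using cyl_subset_cball[OF v, of z a b] b by (force simp: a_def)
  have face: "dist (z + ((x - z) \<bullet> v) *\<^sub>R v) x \<le> b" if "x \<in> cyl z v a b" for x
  proof -
    have "norm (x - z - ((x - z) \<bullet> v) *\<^sub>R v) \<le> b"
      using that by (simp add: cyl_def)
    moreover have "x - z - ((x - z) \<bullet> v) *\<^sub>R v = x - (z + ((x - z) \<bullet> v) *\<^sub>R v)"
      by simp
    ultimately show ?thesis
      by (simp add: dist_norm norm_minus_commute)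
  qed
  have "crosses z v a b g"
    unfolding crosses_def
  proof (intro conjI ballI impI)
    fix x assume x: "x \<in> cyl z v a b"
    then show "\<exists>h'. (g has_derivative h') (at x) \<and> 0 < h' v"
      using sub r g' by blast
    show "0 < g x" if "(x - z) \<bullet> v = a"
    proof -
      have "x \<in> ball (z + a *\<^sub>R v) d"
        using face[OF x] that b by auto
      then show ?thesis
        using d by (auto simp: U_def)
    qed
    show "g x < 0" if "(x - z) \<bullet> v = - a"
    proof -
      have "x \<in> ball (z + (- a) *\<^sub>R v) e"
        using face[OF x] that b by auto
      then show ?thesis
        using e by (auto simp: L_def)
    qed
  qed
  then show ?thesis
    using that[OF a b(1)] sub r by blast
qed

text \<open>The minimum of \<open>g\<close> on \<open>K\<close> is a positive margin for the
  approximation.\<close>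

lemma uniform_limit_eventually_pos:
  fixes g :: "'a::topological_space \<Rightarrow> real"
  assumes "compact K" "continuous_on K g" "\<And>x. x \<in> K \<Longrightarrow> 0 < g x" "uniform_limit K f g F"
  shows "\<forall>\<^sub>F t in F. \<forall>x\<in>K. 0 < f t x"
proof (cases "K = {}")
  case False
  then obtain x0 where x0: "x0 \<in> K" "\<And>x. x \<in> K \<Longrightarrow> g x0 \<le> g x"
    using continuous_attains_inf[OF assms(1) _ assms(2)] by blast
  have "\<forall>\<^sub>F t in F. \<forall>x\<in>K. dist (f t x) (g x) < g x0"
    using assms(4) assms(3)[OF x0(1)] unfolding uniform_limit_iff by blast
  then show ?thesis
    by eventually_elim (use x0(2) in \<open>fastforce simp: dist_real_def\<close>)
qed simp

text \<open>Each condition in \<open>crosses\<close> is positivity of a continuous function on a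
  compact set: of the derivative along \<open>v\<close> on the cylinder, of \<open>g\<close> on the
  top face and of \<open>- g\<close> on the bottom face.\<close>

lemma crosses_eventually:
  fixes g :: "'a::euclidean_space \<Rightarrow> real"
  assumes v: "norm v = 1" and g: "crosses z v a b g"
    and g': "\<And>x. x \<in> cyl z v a b \<Longrightarrow> (g has_derivative g' x) (at x)"
    and cont: "continuous_on (cyl z v a b) (\<lambda>x. g' x v)"
    and f': "\<forall>\<^sub>F t in F. \<forall>x\<in>cyl z v a b. (f t has_derivative f' t x) (at x)"
    and lim: "uniform_limit (cyl z v a b) f g F"
    and lim': "uniform_limit (cyl z v a b) (\<lambda>t x. f' t x v) (\<lambda>x. g' x v) F"
  shows "\<forall>\<^sub>F t in F. crosses z v a b (f t)"
proof -
  let ?E = "\<lambda>c. cyl z v a b \<inter> {x. (x - z) \<bullet> v = c}"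
  have E: "compact (?E c)" for c
    by (intro compact_Int_closed compact_cyl v closed_Collect_eq continuous_intros)
  have contg: "continuous_on (cyl z v a b) g"
    using g' by (auto intro!: continuous_at_imp_continuous_on has_derivative_continuous)
  have 1: "\<forall>\<^sub>F t in F. \<forall>x\<in>cyl z v a b. 0 < f' t x v"
  proof (rule uniform_limit_eventually_pos[OF compact_cyl[OF v] cont _ lim'])
    fix x assume x: "x \<in> cyl z v a b"
    then obtain h' where h': "(g has_derivative h') (at x)" "0 < h' v"
      using g by (auto simp: crosses_def)
    then show "0 < g' x v"
      using has_derivative_unique[OF g'[OF x] h'(1)] by simp
  qed
  have 2: "\<forall>\<^sub>F t in F. \<forall>x\<in>?E a. 0 < f t x"
    by (rule uniform_limit_eventually_pos[OF E continuous_on_subset[OF contg]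
          _ uniform_limit_on_subset[OF lim]]) (use g in \<open>auto simp: crosses_def\<close>)
  have 3: "\<forall>\<^sub>F t in F. \<forall>x\<in>?E (- a). 0 < - f t x"
    by (rule uniform_limit_eventually_pos[OF E continuous_on_subset[OF continuous_on_minus[OF contg]]
          _ uniform_limit_on_subset[OF uniform_limit_uminus[OF lim]]])
       (use g in \<open>auto simp: crosses_def\<close>)
  show ?thesis
    using 1 2 3 f' by eventually_elim (fastforce simp: crosses_def)
qed

section \<open>Charts\<close>

lemma is_chart_inj:
  assumes "is_chart X c"
  shows "inj_on (chart_map c) (chart_dom c)" "chart_dom c \<subseteq> topspace X"
  using assms homeomorphic_imp_injective_map openin_subset unfolding is_chart_def
  by (metis topspace_subtopology_subset, blast)

lemma chart_inv_chart_map: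
  assumes "is_chart X c" "p \<in> chart_dom c"
  shows "chart_inv c (chart_map c p) = p"
  unfolding chart_inv_def by (rule inv_into_f_f[OF is_chart_inj(1)[OF assms(1)] assms(2)])

lemma chart_inv_in_dom: "z \<in> chart_map c ` chart_dom c \<Longrightarrow> chart_inv c z \<in> chart_dom c"
  unfolding chart_inv_def by (rule inv_into_into)

lemma chart_map_chart_inv: "z \<in> chart_map c ` chart_dom c \<Longrightarrow> chart_map c (chart_inv c z) = z"
  unfolding chart_inv_def by (rule f_inv_into_f)

lemma chart_inv_image_eq:
  assumes "is_chart X c" "Z \<subseteq> chart_map c ` chart_dom c"
  shows "chart_inv c ` Z = {p \<in> chart_dom c. chart_map c p \<in> Z}"
  using assms chart_inv_chart_map[OF assms(1)] chart_inv_in_dom chart_map_chart_inv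
  by (force simp: image_iff)

lemma continuous_map_chart:
  assumes "is_chart X c"
  shows "continuous_map (subtopology X (chart_dom c)) euclidean (chart_map c)"
  using assms homeomorphic_imp_continuous_map continuous_map_in_subtopology
  unfolding is_chart_def by blast

lemma continuous_map_chart_inv:
  assumes "is_chart X c"
  shows "continuous_map (top_of_set (chart_map c ` chart_dom c)) X (chart_inv c)"
proof -
  let ?A = "subtopology X (chart_dom c)" and ?B = "top_of_set (chart_map c ` chart_dom c)"
  have "homeomorphic_map ?A ?B (chart_map c)"
    using assms by (simp add: is_chart_def)
  then obtain h where h: "homeomorphic_maps ?A ?B (chart_map c) h"
    unfolding homeomorphic_map_maps by blast
  have A: "topspace ?A = chart_dom c"
    using is_chart_inj(2)[OF assms] by auto
  have "continuous_map ?B ?A (chart_inv c)"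
  proof (rule continuous_map_eq[of _ _ h])
    show "continuous_map ?B ?A h"
      using h by (simp add: homeomorphic_maps_def)
    fix z assume "z \<in> topspace ?B"
    then obtain p where "p \<in> chart_dom c" "z = chart_map c p"
      by auto
    then show "h z = chart_inv c z"
      using h A chart_inv_chart_map[OF assms] unfolding homeomorphic_maps_def by auto
  qed
  then show ?thesis
    by (simp add: continuous_map_in_subtopology)
qed

lemma openin_chart_preimage:
  assumes "is_chart X c" "open U"
  shows "openin X {p \<in> chart_dom c. chart_map c p \<in> U}"
proof -
  have "openin (subtopology X (chart_dom c))
      {p \<in> topspace (subtopology X (chart_dom c)). chart_map c p \<in> U}"
    by (rule openin_continuous_map_preimage[OF continuous_map_chart[OF assms(1)]])
       (use assms(2) in simp)
  moreover have "topspace (subtopology X (chart_dom c)) = chart_dom c"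
    using is_chart_inj(2)[OF assms(1)] by auto
  moreover have "openin X (chart_dom c)"
    using assms(1) by (simp add: is_chart_def)
  ultimately show ?thesis
    using openin_open_subtopology by metis
qed

lemma open_chart_image:
  assumes "is_chart X c" "openin X U"
  shows "open (chart_map c ` (chart_dom c \<inter> U))"
proof -
  have "openin (subtopology X (chart_dom c)) (chart_dom c \<inter> U)"
    using assms(2) by (simp add: openin_subtopology_Int2)
  then have "openin (top_of_set (chart_map c ` chart_dom c)) (chart_map c ` (chart_dom c \<inter> U))"
    using assms(1) homeomorphic_imp_open_map unfolding is_chart_def open_map_def by blast
  then show ?thesis
    using assms(1) openin_open_trans unfolding is_chart_def by blast
qed

lemma connectedin_chart_inv_image:
  assumes "is_chart X c" "connected Z" "Z \<subseteq> chart_map c ` chart_dom c"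
  shows "connectedin X (chart_inv c ` Z)"
  using assms
  by (intro connectedin_continuous_map_image[OF continuous_map_chart_inv[OF assms(1)]])
     (simp add: connectedin_subtopology)

lemma compactin_chart_inv_image:
  assumes "is_chart X c" "compact Z" "Z \<subseteq> chart_map c ` chart_dom c"
  shows "compactin X (chart_inv c ` Z)"
  using assms
  by (intro image_compactin[OF _ continuous_map_chart_inv[OF assms(1)]])
     (simp add: compactin_subtopology)

lemma atlas_chart:
  assumes "maximal_smooth_atlas X C"
  shows "c \<in> C \<Longrightarrow> is_chart X c"
    and "p \<in> topspace X \<Longrightarrow> \<exists>c\<in>C. p \<in> chart_dom c"
  using assms unfolding maximal_smooth_atlas_def by blast+

text \<open>Preimages of small discs under charts are connected open neighbourhoods.\<close>

lemma locally_connected_space_atlas: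
  assumes "maximal_smooth_atlas X C"
  shows "locally_connected_space X"
  unfolding locally_connected_space
proof (intro allI impI)
  fix V x assume "openin X V \<and> x \<in> V"
  then have V: "openin X V" "x \<in> V"
    by auto
  then obtain c where c: "c \<in> C" "x \<in> chart_dom c" "is_chart X c"
    using atlas_chart[OF assms] openin_subset by blast
  have "open (chart_map c ` (chart_dom c \<inter> V))" "chart_map c x \<in> chart_map c ` (chart_dom c \<inter> V)"
    using open_chart_image[OF c(3) V(1)] c V by auto
  then obtain r where r: "0 < r" "ball (chart_map c x) r \<subseteq> chart_map c ` (chart_dom c \<inter> V)"
    by (meson openE)
  then have sub: "ball (chart_map c x) r \<subseteq> chart_map c ` chart_dom c"
    by blast
  let ?U = "chart_inv c ` ball (chart_map c x) r"
  have "openin X ?U"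
    unfolding chart_inv_image_eq[OF c(3) sub] by (rule openin_chart_preimage[OF c(3) open_ball])
  moreover have "connectedin X ?U"
    by (rule connectedin_chart_inv_image[OF c(3) connected_ball sub])
  moreover have "x \<in> ?U"
    using chart_inv_chart_map[OF c(3,2)] r(1) by (metis centre_in_ball imageI)
  moreover have "?U \<subseteq> V"
    using r(2) chart_inv_chart_map[OF c(3)] by fastforce
  ultimately show "\<exists>U. openin X U \<and> connectedin X U \<and> x \<in> U \<and> U \<subseteq> V"
    by blast
qed

section \<open>Smooth functions on surfaces: continuity and sign\<close>

lemma smooth_on_imp:
  assumes "smooth_on W h" "open W"
  shows "z \<in> W \<Longrightarrow> (h has_derivative frechet_derivative h (at z)) (at z)"
    and "continuous_on W h" and "continuous_on W (partial i h)"
proof -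
  have "iter_partial [] h differentiable_on W" "iter_partial [i] h differentiable_on W"
    using assms(1) unfolding smooth_on_def by blast+
  then have h: "h differentiable_on W" "partial i h differentiable_on W"
    by (simp_all add: iter_partial_def)
  then show "continuous_on W h" "continuous_on W (partial i h)"
    using differentiable_imp_continuous_on by blast+
  show "(h has_derivative frechet_derivative h (at z)) (at z)" if "z \<in> W"
    using h(1) assms(2) that by (simp add: differentiable_on_eq_differentiable_at frechet_derivative_works)
qed

lemma continuous_map_smooth_function:
  assumes atlas: "maximal_smooth_atlas (surf_top S) (surf_charts S)" and "smooth_function S h"
  shows "continuous_map (surf_top S) euclideanreal h"
  unfolding continuous_map_def
proof (intro conjI allI impI)
  fix U :: "real set" assume "openin euclideanreal U"
  then have U: "open U"
    by simp
  have "\<exists>V. openin (surf_top S) V \<and> p \<in> V \<and> V \<subseteq> {x \<in> points S. h x \<in> U}"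
    if p: "p \<in> points S" "h p \<in> U" for p
  proof -
    obtain c where c: "c \<in> surf_charts S" "p \<in> chart_dom c" "is_chart (surf_top S) c"
      using atlas_chart[OF atlas] p by blast
    let ?D = "chart_map c ` chart_dom c"
    have D: "open ?D"
      using c by (simp add: is_chart_def)
    have "continuous_on ?D (h \<circ> chart_inv c)"
      using assms(2) c unfolding smooth_function_def by (intro smooth_on_imp(2)[OF _ D]) blast
    then have "open (?D \<inter> (h \<circ> chart_inv c) -` U)"
      using D U by (rule continuous_open_preimage)
    then have "openin (surf_top S) {q \<in> chart_dom c. chart_map c q \<in> ?D \<inter> (h \<circ> chart_inv c) -` U}"
      by (rule openin_chart_preimage[OF c(3)])
    moreover have "{q \<in> chart_dom c. chart_map c q \<in> ?D \<inter> (h \<circ> chart_inv c) -` U} =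
        {q \<in> chart_dom c. h q \<in> U}"
      using chart_inv_chart_map[OF c(3)] by (intro Collect_cong conj_cong refl) simp
    ultimately show ?thesis
      using c p is_chart_inj(2)[OF c(3)] by (intro exI[of _ "{q \<in> chart_dom c. h q \<in> U}"]) auto
  qed
  then show "openin (surf_top S) {x \<in> points S. h x \<in> U}"
    by (subst openin_subopen) blast
qed auto

text \<open>A change of sign would put 0 into the connected image of \<open>Q\<close>.\<close>

lemma sgn_eq_on_connectedin:
  fixes h :: "'a \<Rightarrow> real"
  assumes "connectedin Y Q" "continuous_map Y euclideanreal h" "\<And>x. x \<in> Q \<Longrightarrow> h x \<noteq> 0"
    and "x \<in> Q" "y \<in> Q"
  shows "sgn (h x) = sgn (h y)"
proof -
  have c: "connected (h ` Q)"
    using connectedin_continuous_map_image[OF assms(2,1)] by simp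
  have "0 \<notin> h ` Q"
    using assms(3) by force
  then have "\<not> (h x < 0 \<and> 0 < h y)" "\<not> (h y < 0 \<and> 0 < h x)"
    using connectedD_interval[OF c, of "h x" "h y" 0] connectedD_interval[OF c, of "h y" "h x" 0]
      assms(4,5) by (auto simp: less_imp_le)
  moreover have "h x \<noteq> 0" "h y \<noteq> 0"
    using assms by auto
  ultimately show ?thesis
    by (auto simp: sgn_if)
qed

lemma connected_closure_signed_if_crosses:
  assumes v: "norm v = 1" and h: "crosses z v a b h" and \<sigma>: "\<sigma> \<in> {1, -1}"
  shows "connected {x\<in>cyl z v a b. 0 < \<sigma> * h x}"
    and "x \<in> cyl z v a b \<Longrightarrow> h x = 0 \<Longrightarrow> x \<in> closure {x\<in>cyl z v a b. 0 < \<sigma> * h x}"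
proof -
  note m = crosses_uminus[OF h]
  have v': "norm (- v) = 1"
    using v by simp
  show "connected {x\<in>cyl z v a b. 0 < \<sigma> * h x}"
    using connected_positive_if_crosses[OF v h] connected_positive_if_crosses[OF v' m] \<sigma>
    by (auto simp: cyl_uminus)
  show "x \<in> closure {x\<in>cyl z v a b. 0 < \<sigma> * h x}" if "x \<in> cyl z v a b" "h x = 0"
    using zero_in_closure_positive_if_crosses[OF v h, of x]
      zero_in_closure_positive_if_crosses[OF v' m, of x] \<sigma> that
    by (auto simp: cyl_uminus)
qed

section \<open>Nodal domains inside the unperturbed part\<close>

text \<open>Here \<open>f t\<close> stands for \<open>\<phi> t \<circ> \<iota> t\<close>, so that
  only the base surface occurs. Up to the boundary of \<open>M\<close>, all that is known of
  \<open>f t\<close> is continuity and the location of its zeros; differentiability and convergence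
  are confined to the interior.\<close>

locale nodal_limit =
  fixes S :: "'a surface" and M T :: "'a set" and g :: "'a \<Rightarrow> real"
    and f :: "'t \<Rightarrow> 'a \<Rightarrow> real" and F :: "'t filter"
  assumes Hausdorff: "Hausdorff_space (surf_top S)"
    and atlas: "maximal_smooth_atlas (surf_top S) (surf_charts S)"
    and subsurface: "compact_subsurface S M"
    and T: "compactin (surf_top S) T" "T \<subseteq> surf_top S interior_of M"
    and smooth: "smooth_function S g"
    and regular: "regular_value_on S M g 0"
    and zeros: "{p\<in>M. g p = 0} \<subseteq> T"
    and zeros_f: "\<forall>\<^sub>F t in F. {p\<in>M. f t p = 0} \<subseteq> T"
    and continuous_f: "\<forall>\<^sub>F t in F. continuous_map (subtopology (surf_top S) M) euclideanreal (f t)"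
    and differentiable_f: "\<forall>\<^sub>F t in F. \<forall>c\<in>surf_charts S. \<forall>p\<in>chart_dom c \<inter> surf_top S interior_of M.
      (f t \<circ> chart_inv c) differentiable (at (chart_map c p))"
    and conv: "functions_Cinf_loc_limit S (surf_top S interior_of M) f g F"
begin

abbreviation "X \<equiv> surf_top S"
abbreviation "Y \<equiv> subtopology X M"

lemmas chart = atlas_chart(1)[OF atlas]

lemma compactin_M: "compactin X M"
  using subsurface by (simp add: compact_subsurface_def)

lemma M_subset: "M \<subseteq> points S"
  by (rule compactin_subset_topspace[OF compactin_M])

lemma closedin_M: "closedin X M"
  by (rule compactin_imp_closedin[OF Hausdorff compactin_M])

lemma topspace_Y: "topspace Y = M"
  using M_subset by auto

lemma continuous_g: "continuous_map X euclideanreal g"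
  by (rule continuous_map_smooth_function[OF atlas smooth])

section \<open>Compact connected neighbourhoods in \<open>M\<close>\<close>

lemma interior_Y:
  assumes "openin X U" "p \<in> U" "p \<in> M" "U \<inter> M \<subseteq> Q"
  shows "p \<in> Y interior_of Q"
  unfolding interior_of_def using assms
  by (auto intro!: exI[of _ "U \<inter> M"] simp: openin_subtopology_Int)

text \<open>A chart that straightens the boundary turns the neighbourhood into a half-disc, which is
  compact and convex. The interior point \<open>q\<close> is recorded because the sign of
  \<open>f t\<close> on \<open>Q\<close> will be read off there.\<close>

lemma half_disc_frontier:
  assumes p: "p \<in> M" "p \<notin> X interior_of M" and G: "openin X G" "p \<in> G"
  shows "\<exists>Q. Q \<subseteq> M \<inter> G \<and> compactin X Q \<and> connectedin X Q \<and>
    (\<exists>U. openin X U \<and> p \<in> U \<and> U \<inter> M \<subseteq> Q) \<and> (\<exists>q\<in>Q. q \<in> X interior_of M)"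
proof -
  have "p \<in> X frontier_of M"
    using p closedin_M by (simp add: frontier_of_def closure_of_closedin)
  then obtain c where c: "c \<in> surf_charts S" "p \<in> chart_dom c" "chart_map c p $ 2 = 0"
    and half: "M \<inter> chart_dom c = {q \<in> chart_dom c. 0 \<le> chart_map c q $ 2}"
    using subsurface unfolding compact_subsurface_def by blast
  note ch = chart[OF c(1)]
  have "open (chart_map c ` (chart_dom c \<inter> G))" "chart_map c p \<in> chart_map c ` (chart_dom c \<inter> G)"
    using open_chart_image[OF ch G(1)] c G by auto
  then obtain r where r: "0 < r" "cball (chart_map c p) r \<subseteq> chart_map c ` (chart_dom c \<inter> G)"
    by (meson open_contains_cball)
  have H: "{y. 0 \<le> y $ 2} = {y :: real^2. 0 \<le> axis 2 1 \<bullet> y}"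
    by (simp add: inner_axis')
  define D where "D = cball (chart_map c p) r \<inter> {y. 0 \<le> y $ 2}"
  have D: "compact D" "convex D" "D \<subseteq> chart_map c ` chart_dom c" "D \<subseteq> chart_map c ` (chart_dom c \<inter> G)"
    using r unfolding D_def H
    by (auto intro!: compact_Int_closed closed_halfspace_ge convex_Int
        convex_halfspace_ge)
  let ?Q = "chart_inv c ` D"
  have "?Q \<subseteq> G"
    using D(4) chart_inv_chart_map[OF ch] by fastforce
  moreover have "?Q \<subseteq> M"
    using half D(3) unfolding chart_inv_image_eq[OF ch D(3)] by (auto simp: D_def)
  moreover have "compactin X ?Q" "connectedin X ?Q"
    using compactin_chart_inv_image[OF ch D(1,3)]
      connectedin_chart_inv_image[OF ch convex_connected[OF D(2)] D(3)] by auto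
  moreover have "\<exists>U. openin X U \<and> p \<in> U \<and> U \<inter> M \<subseteq> ?Q"
  proof (intro exI conjI)
    show "openin X {q \<in> chart_dom c. chart_map c q \<in> ball (chart_map c p) r}"
      by (rule openin_chart_preimage[OF ch open_ball])
    show "p \<in> {q \<in> chart_dom c. chart_map c q \<in> ball (chart_map c p) r}"
      using c r by simp
    show "{q \<in> chart_dom c. chart_map c q \<in> ball (chart_map c p) r} \<inter> M \<subseteq> ?Q"
      using half unfolding chart_inv_image_eq[OF ch D(3)] by (auto simp: D_def less_imp_le)
  qed
  moreover have "\<exists>q\<in>?Q. q \<in> X interior_of M"
  proof -
    \<comment> \<open>The centre raised by half the radius: it stays in the half-disc and enters the
      open half-plane, whose preimage under the chart is an open subset of \<open>M\<close>.\<close>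
    let ?w = "chart_map c p + (r / 2) *\<^sub>R axis 2 1"
    have w2: "?w $ 2 = r / 2"
      using c(3) by simp
    have w: "?w \<in> D"
      using r w2 by (simp add: D_def dist_norm)
    have "open {y :: real^2. 0 < y $ 2}"
      by (intro open_Collect_less continuous_intros)
    then have "openin X {q \<in> chart_dom c. chart_map c q \<in> {y. 0 < y $ 2}}"
      by (rule openin_chart_preimage[OF ch])
    moreover have "{q \<in> chart_dom c. chart_map c q \<in> {y. 0 < y $ 2}} \<subseteq> M"
    proof clarify
      fix q assume "q \<in> chart_dom c" "0 < chart_map c q $ 2"
      then have "q \<in> {q \<in> chart_dom c. 0 \<le> chart_map c q $ 2}"
        by simp
      then show "q \<in> M"
        unfolding half[symmetric] by blast
    qed
    ultimately have "{q \<in> chart_dom c. chart_map c q \<in> {y. 0 < y $ 2}} \<subseteq> X interior_of M"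
      by (rule interior_of_maximal[rotated])
    moreover have "chart_inv c ?w \<in> {q \<in> chart_dom c. chart_map c q \<in> {y. 0 < y $ 2}}"
    proof -
      have "?w \<in> chart_map c ` chart_dom c"
        using w D(3) by blast
      then show ?thesis
        using w2 r(1) by (simp add: chart_inv_in_dom chart_map_chart_inv)
    qed
    ultimately show ?thesis
      using w by blast
  qed
  ultimately show ?thesis
    by (intro exI[of _ ?Q]) blast
qed

lemma half_disc:
  assumes p: "p \<in> M" and G: "openin X G" "p \<in> G"
  shows "\<exists>Q. Q \<subseteq> M \<inter> G \<and> compactin X Q \<and> connectedin X Q \<and>
    (\<exists>U. openin X U \<and> p \<in> U \<and> U \<inter> M \<subseteq> Q) \<and> (\<exists>q\<in>Q. q \<in> X interior_of M)"
proof (cases "p \<in> X interior_of M")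
  case True
  obtain c where c: "c \<in> surf_charts S" "p \<in> chart_dom c"
    using atlas_chart(2)[OF atlas] p M_subset by blast
  note ch = chart[OF c(1)]
  let ?G = "G \<inter> X interior_of M"
  have "open (chart_map c ` (chart_dom c \<inter> ?G))" "chart_map c p \<in> chart_map c ` (chart_dom c \<inter> ?G)"
    using open_chart_image[OF ch openin_Int[OF G(1) openin_interior_of]] c G True by blast+
  then obtain r where r: "0 < r" "cball (chart_map c p) r \<subseteq> chart_map c ` (chart_dom c \<inter> ?G)"
    by (meson open_contains_cball)
  let ?D = "cball (chart_map c p) r"
  have D: "?D \<subseteq> chart_map c ` chart_dom c"
    using r by blast
  let ?Q = "chart_inv c ` ?D"
  have "?Q \<subseteq> ?G"
    using r(2) chart_inv_chart_map[OF ch] by fastforce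
  then have "?Q \<subseteq> M \<inter> G"
    using interior_of_subset[of X M] by blast
  moreover have "compactin X ?Q" "connectedin X ?Q"
    using compactin_chart_inv_image[OF ch compact_cball D]
      connectedin_chart_inv_image[OF ch convex_connected[OF convex_cball] D] by auto
  moreover have "\<exists>U. openin X U \<and> p \<in> U \<and> U \<inter> M \<subseteq> ?Q"
  proof (intro exI conjI)
    show "openin X {q \<in> chart_dom c. chart_map c q \<in> ball (chart_map c p) r}"
      by (rule openin_chart_preimage[OF ch open_ball])
    show "p \<in> {q \<in> chart_dom c. chart_map c q \<in> ball (chart_map c p) r}"
      using c r by simp
    show "{q \<in> chart_dom c. chart_map c q \<in> ball (chart_map c p) r} \<inter> M \<subseteq> ?Q"
      unfolding chart_inv_image_eq[OF ch D] by (auto simp: less_imp_le)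
  qed
  moreover have "p \<in> ?Q"
    using c r unfolding chart_inv_image_eq[OF ch D] by auto
  ultimately show ?thesis
    using True by (intro exI[of _ ?Q]) blast
qed (use half_disc_frontier[OF p _ G] in blast)

section \<open>Signs of the perturbed functions and pieces around each point\<close>

lemma uniform_limits:
  assumes "c \<in> surf_charts S" "compact K" "K \<subseteq> chart_map c ` (chart_dom c \<inter> X interior_of M)"
  shows "uniform_limit K (\<lambda>t. f t \<circ> chart_inv c) (g \<circ> chart_inv c) F"
    and "uniform_limit K (\<lambda>t. partial i (f t \<circ> chart_inv c)) (partial i (g \<circ> chart_inv c)) F"
proof -
  have "uniform_limit K (\<lambda>t. iter_partial l (f t \<circ> chart_inv c)) (iter_partial l (g \<circ> chart_inv c)) F" for l
    using conv assms unfolding functions_Cinf_loc_limit_def Cinf_loc_limit_def by blast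
  from this[of "[]"] this[of "[i]"]
  show "uniform_limit K (\<lambda>t. f t \<circ> chart_inv c) (g \<circ> chart_inv c) F"
    "uniform_limit K (\<lambda>t. partial i (f t \<circ> chart_inv c)) (partial i (g \<circ> chart_inv c)) F"
    by (simp_all add: iter_partial_def)
qed

text \<open>Inside one chart and the interior of \<open>M\<close> the convergence is uniform on
  compact sets; multiplication by \<open>\<sigma>\<close> reduces both signs to positivity.\<close>

lemma eventually_sgn_eq_on_compactin:
  assumes "c \<in> surf_charts S" "compactin X Q" "Q \<subseteq> chart_dom c \<inter> X interior_of M"
    and "\<And>x. x \<in> Q \<Longrightarrow> sgn (g x) = \<sigma>" "\<sigma> \<noteq> 0"
  shows "\<forall>\<^sub>F t in F. \<forall>x\<in>Q. sgn (f t x) = \<sigma>"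
proof (cases "Q = {}")
  case False
  then obtain x0 where "x0 \<in> Q"
    by blast
  then have \<sigma>: "\<sigma> \<in> {1, -1}"
    using assms(4)[of x0] assms(5) by (auto simp: sgn_if split: if_splits)
  note ch = chart[OF assms(1)]
  let ?K = "chart_map c ` Q"
  have inv: "chart_inv c (chart_map c x) = x" if "x \<in> Q" for x
    using chart_inv_chart_map[OF ch] assms(3) that by blast
  have "compactin (subtopology X (chart_dom c)) Q"
    using assms(2,3) by (simp add: compactin_subtopology)
  then have K: "compact ?K"
    using image_compactin[OF _ continuous_map_chart[OF ch]] by simp
  have Ksub: "?K \<subseteq> chart_map c ` (chart_dom c \<inter> X interior_of M)"
    using assms(3) by blast
  have D: "open (chart_map c ` chart_dom c)" "?K \<subseteq> chart_map c ` chart_dom c"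
    using ch assms(3) by (auto simp: is_chart_def)
  have "smooth_on (chart_map c ` chart_dom c) (g \<circ> chart_inv c)"
    using smooth assms(1) by (simp add: smooth_function_def)
  then have contg: "continuous_on ?K (g \<circ> chart_inv c)"
    using continuous_on_subset[OF smooth_on_imp(2)[OF _ D(1)] D(2)] by blast
  have "\<forall>\<^sub>F t in F. \<forall>z\<in>?K. 0 < \<sigma> * (f t \<circ> chart_inv c) z"
  proof (rule uniform_limit_eventually_pos[OF K])
    show "continuous_on ?K (\<lambda>z. \<sigma> * (g \<circ> chart_inv c) z)"
      by (intro continuous_on_mult_left contg)
    show "uniform_limit ?K (\<lambda>t z. \<sigma> * (f t \<circ> chart_inv c) z) (\<lambda>z. \<sigma> * (g \<circ> chart_inv c) z) F"
      using bounded_linear.uniform_limit[OF bounded_linear_mult_right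
          uniform_limits(1)[OF assms(1) K Ksub]] .
    fix z assume "z \<in> ?K"
    then obtain x where x: "x \<in> Q" "z = chart_map c x"
      by blast
    have "g x \<noteq> 0" "g x * sgn (g x) = \<bar>g x\<bar>"
      using assms(4)[OF x(1)] assms(5) by (auto simp: mult_sgn_abs abs_sgn)
    then show "0 < \<sigma> * (g \<circ> chart_inv c) z"
      using assms(4)[OF x(1)] inv[OF x(1)] x by (simp add: mult.commute)
  qed
  then show ?thesis
  proof eventually_elim
    case (elim t)
    then have elim: "0 < \<sigma> * f t x" if "x \<in> Q" for x
      using inv[OF that] that by auto
    have "sgn (f t x) = \<sigma>" if "x \<in> Q" for x
      using elim[OF that] \<sigma> by (auto simp: sgn_if zero_less_mult_iff)
    then show ?case
      by blast
  qed
qed simp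

lemma eventually_sgn_eq_at_interior:
  assumes "q \<in> X interior_of M" "g q \<noteq> 0"
  shows "\<forall>\<^sub>F t in F. sgn (f t q) = sgn (g q)"
proof -
  have q: "q \<in> points S"
    using assms interior_of_subset_topspace[of X M] by blast
  then obtain c where "c \<in> surf_charts S" "q \<in> chart_dom c"
    using atlas_chart(2)[OF atlas] by blast
  then have "\<forall>\<^sub>F t in F. \<forall>x\<in>{q}. sgn (f t x) = sgn (g q)"
    by (rule_tac eventually_sgn_eq_on_compactin) (use assms q in \<open>auto simp: sgn_zero_iff\<close>)
  then show ?thesis
    by simp
qed

lemma nonzero_piece:
  assumes p: "p \<in> M" "g p \<noteq> 0"
  shows "\<exists>Q. Q \<subseteq> M \<and> closedin X Q \<and> connectedin X Q \<and> p \<in> Y interior_of Q \<and>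
    (\<forall>x\<in>Q. sgn (g x) = sgn (g p)) \<and> (\<forall>\<^sub>F t in F. \<forall>x\<in>Q. sgn (f t x) = sgn (g p))"
proof -
  have "\<exists>Q U. Q \<subseteq> M \<and> compactin X Q \<and> connectedin X Q \<and> openin X U \<and> p \<in> U \<and> U \<inter> M \<subseteq> Q \<and>
    (\<forall>x\<in>Q. sgn (g x) = sgn (g p)) \<and> (\<forall>\<^sub>F t in F. \<forall>x\<in>Q. sgn (f t x) = sgn (g p))"
  proof (cases "p \<in> T")
    \<comment> \<open>Points of \<open>T\<close> are interior to \<open>M\<close>, so
      \<open>Q\<close> can be taken inside the interior and one chart, where uniform convergence
      decides the sign.\<close>
    case True
    obtain c where c: "c \<in> surf_charts S" "p \<in> chart_dom c"
      using atlas_chart(2)[OF atlas] p M_subset by blast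
    note ch = chart[OF c(1)]
    let ?I = "{x :: real. 0 < sgn (g p) * x}"
    have I: "open ?I"
      by (intro open_Collect_less continuous_intros)
    have "openin X {x \<in> points S. g x \<in> ?I}"
      by (rule openin_continuous_map_preimage[OF continuous_g]) (use I in simp)
    moreover have "openin X (chart_dom c)"
      using ch by (simp add: is_chart_def)
    ultimately have G: "openin X ({x \<in> points S. g x \<in> ?I} \<inter> (chart_dom c \<inter> X interior_of M))"
      by (intro openin_Int openin_interior_of)
    have "p \<in> {x \<in> points S. g x \<in> ?I} \<inter> (chart_dom c \<inter> X interior_of M)"
      using p c T True M_subset by (auto simp: sgn_if)
    then obtain Q U where Q: "Q \<subseteq> M \<inter> ({x \<in> points S. g x \<in> ?I} \<inter> (chart_dom c \<inter> X interior_of M))"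
      "compactin X Q" "connectedin X Q" "openin X U" "p \<in> U" "U \<inter> M \<subseteq> Q"
      using half_disc[OF p(1) G] by auto
    have sg: "sgn (g x) = sgn (g p)" if "x \<in> Q" for x
    proof -
      have "0 < sgn (g p) * g x"
        using Q(1) that by blast
      then show ?thesis
        by (auto simp: sgn_if split: if_splits)
    qed
    have "\<forall>\<^sub>F t in F. \<forall>x\<in>Q. sgn (f t x) = sgn (g p)"
      by (rule eventually_sgn_eq_on_compactin[OF c(1) Q(2)])
         (use Q(1) sg p(2) in \<open>auto simp: sgn_zero_iff\<close>)
    then show ?thesis
      using Q sg by (intro exI[of _ Q] exI[of _ U]) blast
  next
    \<comment> \<open>Now \<open>Q\<close> may touch the boundary. It avoids \<open>T\<close>, so
      neither function vanishes on it and each has constant sign there; convergence is used only at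
      the interior point \<open>q\<close>.\<close>
    case False
    have "openin X (points S - T)"
      using compactin_imp_closedin[OF Hausdorff T(1)] by blast
    then obtain Q U q where Q: "Q \<subseteq> M \<inter> (points S - T)" "compactin X Q" "connectedin X Q"
      "openin X U" "p \<in> U" "U \<inter> M \<subseteq> Q" and q: "q \<in> Q" "q \<in> X interior_of M"
      using half_disc[OF p(1), of "points S - T"] p M_subset False by blast
    have pQ: "p \<in> Q"
      using Q p by blast
    have gQ: "g x \<noteq> 0" if "x \<in> Q" for x
      using Q(1) zeros that by blast
    have sg: "sgn (g x) = sgn (g p)" if "x \<in> Q" for x
      by (rule sgn_eq_on_connectedin[OF Q(3) continuous_g gQ that pQ])
    have "\<forall>\<^sub>F t in F. sgn (f t q) = sgn (g q)"
      by (rule eventually_sgn_eq_at_interior[OF q(2) gQ[OF q(1)]])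
    with zeros_f continuous_f have "\<forall>\<^sub>F t in F. \<forall>x\<in>Q. sgn (f t x) = sgn (g p)"
    proof eventually_elim
      case (elim t)
      have "connectedin Y Q"
        using Q by (simp add: connectedin_subtopology)
      moreover have "f t x \<noteq> 0" if "x \<in> Q" for x
        using elim(1) Q(1) that by blast
      ultimately have "sgn (f t x) = sgn (f t q)" if "x \<in> Q" for x
        using sgn_eq_on_connectedin[of Y Q "f t" x q] elim(2) q(1) that by blast
      then show ?case
        using elim(3) sg[OF q(1)] by simp
    qed
    then show ?thesis
      using Q sg by (intro exI[of _ Q] exI[of _ U]) blast
  qed
  then obtain Q U where Q: "Q \<subseteq> M" "compactin X Q" "connectedin X Q" "openin X U" "p \<in> U" "U \<inter> M \<subseteq> Q"
    "\<forall>x\<in>Q. sgn (g x) = sgn (g p)" "\<forall>\<^sub>F t in F. \<forall>x\<in>Q. sgn (f t x) = sgn (g p)"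
    by blast
  then show ?thesis
    using compactin_imp_closedin[OF Hausdorff Q(2)] interior_Y[OF Q(4,5) p(1) Q(6)] by blast
qed

text \<open>Each signed part is either all of \<open>Q\<close> or empty, and the closure condition
  is vacuous because \<open>g\<close> has no zero on \<open>Q\<close>.\<close>

lemma sign_piece_if_sgn_eq:
  assumes Q: "Q \<subseteq> M" "closedin X Q" "connectedin X Q" and s: "s \<noteq> 0"
    and sg: "\<forall>x\<in>Q. sgn (g x) = s" "\<forall>\<^sub>F t in F. \<forall>x\<in>Q. sgn (f t x) = s"
  shows "sign_piece F Y f g Q"
proof -
  have conn: "connectedin Y {x\<in>Q. 0 < \<sigma> * h x}" if "\<forall>x\<in>Q. sgn (h x) = s" for \<sigma> h
  proof -
    have "{x\<in>Q. 0 < \<sigma> * h x} = Q \<or> {x\<in>Q. 0 < \<sigma> * h x} = {}"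
    proof -
      have "0 < \<sigma> * h x \<longleftrightarrow> 0 < \<sigma> * s" if "x \<in> Q" for x
        using \<open>\<forall>x\<in>Q. sgn (h x) = s\<close> that s by (auto simp: sgn_if zero_less_mult_iff split: if_splits)
      then show ?thesis
        by (cases "0 < \<sigma> * s") auto
    qed
    then have "connectedin X {x\<in>Q. 0 < \<sigma> * h x}"
      using Q(3) by (metis connectedin_empty)
    then show ?thesis
      using Q(1) by (auto simp: connectedin_subtopology)
  qed
  have "g x \<noteq> 0" if "x \<in> Q" for x
    using sg(1) s that by force
  moreover have "closedin Y Q"
    using Q closedin_subset_topspace by blast
  moreover have "\<forall>\<^sub>F t in F. connectedin Y {x\<in>Q. 0 < \<sigma> * f t x}" for \<sigma>
    using sg(2) by eventually_elim (rule conn)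
  ultimately show ?thesis
    unfolding sign_piece_def using conn[OF sg(1)] by auto
qed

text \<open>The piece is a cylinder in a chart, centred at the zero, with axis along a direction in
  which regularity makes the derivative positive. \<open>C^1\<close> convergence lets
  \<open>f t\<close> cross the same cylinder.\<close>

lemma zero_piece:
  assumes p: "p \<in> M" "g p = 0"
  shows "\<exists>Q. p \<in> Y interior_of Q \<and> sign_piece F Y f g Q"
proof -
  have pI: "p \<in> X interior_of M"
    using p zeros T by blast
  obtain c where c: "c \<in> surf_charts S" "p \<in> chart_dom c"
    using atlas_chart(2)[OF atlas] p M_subset by blast
  note ch = chart[OF c(1)]
  let ?W = "chart_map c ` (chart_dom c \<inter> X interior_of M)"
  let ?D = "chart_map c ` chart_dom c"
  let ?z = "chart_map c p" and ?g = "g \<circ> chart_inv c"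
  let ?g' = "\<lambda>x. frechet_derivative ?g (at x)"
  have W: "open ?W" "?z \<in> ?W" "?W \<subseteq> ?D"
    using open_chart_image[OF ch] pI c by auto
  have D: "open ?D"
    using ch by (simp add: is_chart_def)
  have sm: "smooth_on ?D ?g"
    using smooth c(1) by (simp add: smooth_function_def)
  have g': "(?g has_derivative ?g' x) (at x)" if "x \<in> ?W" for x
    using smooth_on_imp(1)[OF sm D] that W(3) by blast
  \<comment> \<open>Regularity speaks of a derivative within \<open>M\<close>. As \<open>p\<close>
    is interior, it is the full derivative.\<close>
  obtain L where L: "(?g has_derivative L) (at ?z within chart_map c ` (M \<inter> chart_dom c))" "L \<noteq> (\<lambda>_. 0)"
    using regular p c unfolding regular_value_on_def by blast
  have "?W \<subseteq> chart_map c ` (M \<inter> chart_dom c)"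
    using interior_of_subset[of X M] by blast
  then have "(?g has_derivative L) (at ?z within ?W)"
    using has_derivative_subset[OF L(1)] by blast
  then have "(?g has_derivative L) (at ?z)"
    by (simp add: at_within_open[OF W(2,1)])
  then have "?g' ?z = L"
    using has_derivative_unique[OF g'[OF W(2)]] by blast
  then obtain y where y: "?g' ?z y \<noteq> 0"
    using L(2) by auto
  have lin: "linear (?g' x)" if "x \<in> ?W" for x
    using g'[OF that] has_derivative_linear by blast
  have "?g' ?z y = (\<Sum>i\<in>UNIV. y $ i * ?g' ?z (axis i 1))"
  proof -
    have "?g' ?z y = ?g' ?z (\<Sum>i\<in>UNIV. y $ i *\<^sub>R axis i 1)"
      by (simp add: basis_expansion scalar_mult_eq_scaleR[symmetric])
    also have "\<dots> = (\<Sum>i\<in>UNIV. y $ i * ?g' ?z (axis i 1))"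
      by (simp only: linear_sum[OF lin[OF W(2)]] linear_scale[OF lin[OF W(2)]] real_scaleR_def)
    finally show ?thesis .
  qed
  then obtain i where i: "?g' ?z (axis i 1) \<noteq> 0"
    using y by (metis (no_types, lifting) mult_zero_right sum.neutral)
  \<comment> \<open>A nonzero differential is nonzero on some basis vector. Taking \<open>v\<close>
    as plus or minus that vector makes the derivative along \<open>v\<close> a multiple of a partial
    derivative, for which continuity and convergence are available.\<close>
  define \<tau> where "\<tau> = sgn (?g' ?z (axis i 1))"
  define v :: "real^2" where "v = \<tau> *\<^sub>R axis i 1"
  have v: "norm v = 1"
    using i by (simp add: v_def \<tau>_def sgn_if)
  have g'v: "?g' x v = \<tau> * partial i ?g x" if "x \<in> ?W" for x
    using linear_scale[OF lin[OF that]] by (simp add: v_def partial_def)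
  have pos: "0 < ?g' ?z v"
    using i g'v[OF W(2)] by (auto simp: \<tau>_def partial_def sgn_if)
  have contp: "continuous_on ?W (\<lambda>x. \<tau> * partial i ?g x)"
    by (intro continuous_on_mult_left continuous_on_subset[OF smooth_on_imp(3)[OF sm D] W(3)])
  then have cont: "continuous_on ?W (\<lambda>x. ?g' x v)"
    by (rule continuous_on_eq) (simp add: g'v)
  have gz: "?g ?z = 0"
    using p chart_inv_chart_map[OF ch c(2)] by simp
  obtain a b where ab: "0 < a" "0 < b" "cyl ?z v a b \<subseteq> ?W" "crosses ?z v a b ?g"
    using crosses_exists[OF W(1,2) v g' cont gz pos] by blast
  let ?C = "cyl ?z v a b"
  let ?Q = "chart_inv c ` ?C"
  have C: "?C \<subseteq> ?D" "compact ?C"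
    using ab(3) W(3) compact_cyl[OF v] by auto
  have f': "\<forall>\<^sub>F t in F. \<forall>x\<in>?C.
      ((f t \<circ> chart_inv c) has_derivative frechet_derivative (f t \<circ> chart_inv c) (at x)) (at x)"
    using differentiable_f
  proof eventually_elim
    case (elim t)
    then show ?case
      using ab(3) c(1) by (auto simp: frechet_derivative_works[symmetric])
  qed
  have evc: "\<forall>\<^sub>F t in F. crosses ?z v a b (f t \<circ> chart_inv c)"
  proof (rule crosses_eventually[OF v ab(4) g' _ f'])
    show "x \<in> ?W" if "x \<in> ?C" for x
      using ab(3) that by blast
    show "continuous_on ?C (\<lambda>x. ?g' x v)"
      by (rule continuous_on_subset[OF cont ab(3)])
    show "uniform_limit ?C (\<lambda>t. f t \<circ> chart_inv c) ?g F"
      by (rule uniform_limits(1)[OF c(1) C(2) ab(3)])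
    have "uniform_limit ?C (\<lambda>t x. \<tau> * partial i (f t \<circ> chart_inv c) x) (\<lambda>x. \<tau> * partial i ?g x) F"
      using bounded_linear.uniform_limit[OF bounded_linear_mult_right
          uniform_limits(2)[OF c(1) C(2) ab(3)]] .
    \<comment> \<open>The directional derivative of \<open>f t\<close> is \<open>\<tau>\<close>
      times the partial derivative by linearity, which relies on differentiability; hence the
      identity holds only eventually.\<close>
    then show "uniform_limit ?C (\<lambda>t x. frechet_derivative (f t \<circ> chart_inv c) (at x) v) (\<lambda>x. ?g' x v) F"
    proof (rule uniform_limit_cong[THEN iffD1, rotated 2])
      show "\<forall>\<^sub>F t in F. \<forall>x\<in>?C. \<tau> * partial i (f t \<circ> chart_inv c) x =
          frechet_derivative (f t \<circ> chart_inv c) (at x) v"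
        using f'
      proof eventually_elim
        case (elim t)
        have "frechet_derivative (f t \<circ> chart_inv c) (at x) v = \<tau> * partial i (f t \<circ> chart_inv c) x"
          if "x \<in> ?C" for x
        proof -
          have "linear (frechet_derivative (f t \<circ> chart_inv c) (at x))"
            using elim that has_derivative_linear by blast
          then show ?thesis
            by (simp add: v_def partial_def linear_scale)
        qed
        then show ?case
          by simp
      qed
      show "\<tau> * partial i ?g x = ?g' x v" if "x \<in> ?C" for x
        using g'v ab(3) that by auto
    qed
  qed
  have QM: "?Q \<subseteq> M"
    using ab(3) interior_of_subset[of X M] chart_inv_chart_map[OF ch] by fastforce
  have Qs: "{x\<in>?Q. 0 < \<sigma> * h x} = chart_inv c ` {x\<in>?C. 0 < \<sigma> * (h \<circ> chart_inv c) x}" for h :: "'a \<Rightarrow> real" and \<sigma>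
    by auto
  have conn: "connectedin Y {x\<in>?Q. 0 < \<sigma> * h x}"
    if "crosses ?z v a b (h \<circ> chart_inv c)" "\<sigma> \<in> {1, -1}" for h \<sigma>
  proof -
    have "connectedin X {x\<in>?Q. 0 < \<sigma> * h x}"
      unfolding Qs using connected_closure_signed_if_crosses(1)[OF v that] C(1)
      by (intro connectedin_chart_inv_image[OF ch]) auto
    then show ?thesis
      using QM by (auto simp: connectedin_subtopology)
  qed
  have clos: "x \<in> Y closure_of {x\<in>?Q. 0 < \<sigma> * g x}"
    if x: "x \<in> ?Q" "g x = 0" "\<sigma> \<in> {1, -1}" for x \<sigma>
  proof -
    let ?P = "{x\<in>?C. 0 < \<sigma> * ?g x}"
    obtain w where w: "w \<in> ?C" "x = chart_inv c w"
      using x by blast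
    \<comment> \<open>Being in the closure is obtained in the plane and carried to the surface by
      continuity of the inverse chart.\<close>
    have "w \<in> closure ?P"
      using connected_closure_signed_if_crosses(2)[OF v ab(4) x(3) w(1)] w x by auto
    moreover have "?D \<inter> ?P = ?P"
      using C(1) by blast
    ultimately have "w \<in> top_of_set ?D closure_of ?P"
      using w C(1) by (auto simp: closure_of_subtopology)
    then have "x \<in> X closure_of {x\<in>?Q. 0 < \<sigma> * g x}"
      unfolding Qs w(2) using continuous_map_image_closure_subset[OF continuous_map_chart_inv[OF ch]] by blast
    moreover have "M \<inter> {x\<in>?Q. 0 < \<sigma> * g x} = {x\<in>?Q. 0 < \<sigma> * g x}"
      using QM by blast
    ultimately show ?thesis
      using x QM by (auto simp: closure_of_subtopology)
  qed
  have "closedin Y ?Q"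
    using compactin_imp_closedin[OF Hausdorff compactin_chart_inv_image[OF ch C(2,1)]] QM
    by (rule closedin_subset_topspace)
  moreover have "\<forall>\<^sub>F t in F. connectedin Y {x\<in>?Q. 0 < \<sigma> * f t x}" if "\<sigma> \<in> {1, -1}" for \<sigma>
    using evc by eventually_elim (rule conn[OF _ that])
  ultimately have "sign_piece F Y f g ?Q"
    unfolding sign_piece_def using conn[OF ab(4)] clos by blast
  moreover have "p \<in> Y interior_of ?Q"
  proof (rule interior_Y[OF _ _ p(1)])
    let ?B = "ball ?z (min a (b / 2))"
    show "openin X {q \<in> chart_dom c. chart_map c q \<in> ?B}"
      by (rule openin_chart_preimage[OF ch open_ball])
    show "p \<in> {q \<in> chart_dom c. chart_map c q \<in> ?B}"
      using c ab by simp
    show "{q \<in> chart_dom c. chart_map c q \<in> ?B} \<inter> M \<subseteq> ?Q"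
      unfolding chart_inv_image_eq[OF ch C(1)] using ball_subset_cyl[OF v] by blast
  qed
  ultimately show ?thesis
    by blast
qed

lemma eventually_card_components:
  "\<forall>\<^sub>F t in F.
      finite (connected_components_of (subtopology X {x\<in>M. g x \<noteq> 0})) \<and>
      finite (connected_components_of (subtopology X {x\<in>M. f t x \<noteq> 0})) \<and>
      card (connected_components_of (subtopology X {x\<in>M. g x \<noteq> 0})) =
      card (connected_components_of (subtopology X {x\<in>M. f t x \<noteq> 0}))"
proof -
  have sub: "subtopology Y {x\<in>topspace Y. h x \<noteq> 0} = subtopology X {x\<in>M. h x \<noteq> 0}" for h :: "'a \<Rightarrow> real"
    unfolding topspace_Y subtopology_subtopology by (intro arg_cong[of _ _ "subtopology X"]) blast
  have piece: "\<exists>Q. p \<in> Y interior_of Q \<and> sign_piece F Y f g Q" if p: "p \<in> topspace Y" for p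
  proof (cases "g p = 0")
    case False
    then obtain Q where Q: "Q \<subseteq> M" "closedin X Q" "connectedin X Q" "p \<in> Y interior_of Q"
      "\<forall>x\<in>Q. sgn (g x) = sgn (g p)" "\<forall>\<^sub>F t in F. \<forall>x\<in>Q. sgn (f t x) = sgn (g p)"
      using nonzero_piece[of p] p unfolding topspace_Y by auto
    have "sgn (g p) \<noteq> 0"
      using False by (simp add: sgn_zero_iff)
    then show ?thesis
      using sign_piece_if_sgn_eq[OF Q(1-3) _ Q(5,6)] Q(4) by blast
  qed (use zero_piece p in \<open>simp add: topspace_Y\<close>)
  have sign: "\<exists>U. openin Y U \<and> p \<in> U \<and> (\<forall>\<^sub>F t in F. \<forall>x\<in>U. sgn (f t x) = sgn (g x))"
    if p: "p \<in> topspace Y" "g p \<noteq> 0" for p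
  proof -
    obtain Q where Q: "p \<in> Y interior_of Q"
      "\<forall>x\<in>Q. sgn (g x) = sgn (g p)" "\<forall>\<^sub>F t in F. \<forall>x\<in>Q. sgn (f t x) = sgn (g p)"
      using nonzero_piece[of p] p unfolding topspace_Y by auto
    have "\<forall>\<^sub>F t in F. \<forall>x\<in>Y interior_of Q. sgn (f t x) = sgn (g x)"
      using Q(3) by eventually_elim (use Q(2) interior_of_subset[of Y Q] in auto)
    then show ?thesis
      using Q(1) by (intro exI[of _ "Y interior_of Q"]) auto
  qed
  have "compact_space Y"
    using compactin_M compactin_subspace by blast
  then have "\<forall>\<^sub>F t in F.
      finite (connected_components_of (subtopology Y {x\<in>topspace Y. g x \<noteq> 0})) \<and>
      finite (connected_components_of (subtopology Y {x\<in>topspace Y. f t x \<noteq> 0})) \<and>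
      card (connected_components_of (subtopology Y {x\<in>topspace Y. g x \<noteq> 0})) =
      card (connected_components_of (subtopology Y {x\<in>topspace Y. f t x \<noteq> 0}))"
    by (rule eventually_card_components_nonzero[OF _ continuous_map_from_subtopology[OF continuous_g]
          continuous_f sign piece])
  then show ?thesis
    unfolding sub .
qed

end

section \<open>Embedded pieces\<close>

lemma closed_surface:
  assumes "closed_riemannian_surface S"
  shows "points S \<noteq> {}" "compact_space (surf_top S)" "connected_space (surf_top S)"
    "Hausdorff_space (surf_top S)" "maximal_smooth_atlas (surf_top S) (surf_charts S)"
  using assms unfolding closed_riemannian_surface_def by blast+

lemma embedding_map_subtopologyD:
  assumes "embedding_map (subtopology X M) Z \<iota>" "M \<subseteq> topspace X"
  shows "inj_on \<iota> M" "continuous_map (subtopology X M) Z \<iota>" "\<iota> ` M \<subseteq> topspace Z"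
proof -
  have tM: "topspace (subtopology X M) = M"
    using assms(2) by auto
  have h: "homeomorphic_map (subtopology X M) (subtopology Z (\<iota> ` M)) \<iota>"
    using assms(1) unfolding embedding_map_def tM .
  show "inj_on \<iota> M"
    using homeomorphic_imp_injective_map[OF h] unfolding tM .
  show c: "continuous_map (subtopology X M) Z \<iota>"
    using homeomorphic_imp_continuous_map[OF h] by (simp add: continuous_map_in_subtopology)
  show "\<iota> ` M \<subseteq> topspace Z"
    using continuous_map_image_subset_topspace[OF c] unfolding tM .
qed

text \<open>Read in charts, the embedding is a continuous injection from an open subset of the plane
  into the plane, so its image is open by invariance of domain.\<close>

lemma openin_embedding_image_interior:
  assumes atlas: "maximal_smooth_atlas (surf_top S) (surf_charts S)"
    "maximal_smooth_atlas (surf_top S') (surf_charts S')"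
    and M: "M \<subseteq> points S" and emb: "embedding_map (subtopology (surf_top S) M) (surf_top S') \<iota>"
  shows "openin (surf_top S') (\<iota> ` (surf_top S interior_of M))"
proof (subst openin_subopen, intro ballI)
  let ?X = "surf_top S" and ?X' = "surf_top S'"
  note \<iota> = embedding_map_subtopologyD[OF emb M]
  fix y assume "y \<in> \<iota> ` (?X interior_of M)"
  then obtain p where p: "p \<in> ?X interior_of M" "y = \<iota> p"
    by blast
  have pM: "p \<in> M"
    using p interior_of_subset[of ?X M] by blast
  obtain c where c: "c \<in> surf_charts S" "p \<in> chart_dom c"
    using atlas_chart(2)[OF atlas(1)] pM M by blast
  obtain d where d: "d \<in> surf_charts S'" "\<iota> p \<in> chart_dom d"
    using atlas_chart(2)[OF atlas(2)] pM \<iota>(3) by blast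
  note ch = atlas_chart(1)[OF atlas(1) c(1)] and dh = atlas_chart(1)[OF atlas(2) d(1)]
  have "openin ?X' (chart_dom d)"
    using dh by (simp add: is_chart_def)
  then have "openin (subtopology ?X M) {q \<in> topspace (subtopology ?X M). \<iota> q \<in> chart_dom d}"
    by (rule openin_continuous_map_preimage[OF \<iota>(2)])
  then obtain U where U: "openin ?X U" "{q \<in> topspace (subtopology ?X M). \<iota> q \<in> chart_dom d} = U \<inter> M"
    unfolding openin_subtopology by blast
  \<comment> \<open>Restricting to points that \<open>\<iota>\<close> sends into the domain of
    \<open>d\<close> makes the coordinate expression \<open>?h\<close> meaningful on all of
    \<open>V\<close>.\<close>
  define G where "G = ?X interior_of M \<inter> U"
  have Gop: "openin ?X G"
    unfolding G_def by (rule openin_Int[OF openin_interior_of U(1)])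
  have GM: "G \<subseteq> M"
    unfolding G_def using interior_of_subset[of ?X M] by blast
  have Gd: "\<iota> q \<in> chart_dom d" if "q \<in> G" for q
    using that U(2) GM unfolding G_def by blast
  have pG: "p \<in> G"
    using p(1) U(2) d(2) pM M unfolding G_def by auto
  define V where "V = chart_map c ` (chart_dom c \<inter> G)"
  have V: "open V" "V \<subseteq> chart_map c ` chart_dom c"
    unfolding V_def using open_chart_image[OF ch Gop] by auto
  have inv: "chart_inv c ` V = chart_dom c \<inter> G"
    unfolding V_def image_image using chart_inv_chart_map[OF ch] by force
  let ?h = "\<lambda>z. chart_map d (\<iota> (chart_inv c z))"
  have 1: "continuous_map (top_of_set V) (subtopology ?X M) (chart_inv c)"
    using continuous_map_from_subtopology_mono[OF continuous_map_chart_inv[OF ch] V(2)] inv GM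
    by (auto simp: continuous_map_in_subtopology)
  have 2: "continuous_map (top_of_set V) (subtopology ?X' (chart_dom d)) (\<lambda>z. \<iota> (chart_inv c z))"
    using continuous_map_compose[OF 1 \<iota>(2)] inv Gd
    by (auto simp: continuous_map_in_subtopology o_def)
  have "continuous_on V ?h"
    using continuous_map_compose[OF 2 continuous_map_chart[OF dh]] by (simp add: o_def)
  moreover have "inj_on ?h V"
  proof (rule inj_onI)
    fix z w assume zw: "z \<in> V" "w \<in> V" "?h z = ?h w"
    have m: "chart_inv c z \<in> chart_dom c \<inter> G" "chart_inv c w \<in> chart_dom c \<inter> G"
      using zw inv by blast+
    then have "\<iota> (chart_inv c z) = \<iota> (chart_inv c w)"
      using inj_onD[OF is_chart_inj(1)[OF dh] zw(3)] Gd by blast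
    then have "chart_inv c z = chart_inv c w"
      using inj_onD[OF \<iota>(1)] m GM by blast
    then show "z = w"
      using chart_map_chart_inv zw V(2) by (metis subsetD)
  qed
  ultimately have "open (?h ` V)"
    using invariance_of_domain V(1) by blast
  then have "openin ?X' {q \<in> chart_dom d. chart_map d q \<in> ?h ` V}"
    by (rule openin_chart_preimage[OF dh])
  moreover have "y \<in> {q \<in> chart_dom d. chart_map d q \<in> ?h ` V}"
  proof -
    have "chart_map c p \<in> V" "chart_inv c (chart_map c p) = p"
      using pG c chart_inv_chart_map[OF ch] by (auto simp: V_def)
    then show ?thesis
      using p(2) d(2) by (metis (mono_tags, lifting) image_eqI mem_Collect_eq)
  qed
  moreover have "{q \<in> chart_dom d. chart_map d q \<in> ?h ` V} \<subseteq> \<iota> ` (?X interior_of M)"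
  proof clarify
    fix q z assume q: "q \<in> chart_dom d" "chart_map d q = ?h z" "z \<in> V"
    have m: "chart_inv c z \<in> G"
      using q(3) inv by blast
    have "q = \<iota> (chart_inv c z)"
      by (rule inj_onD[OF is_chart_inj(1)[OF dh] q(2,1) Gd[OF m]])
    then show "q \<in> \<iota> ` (?X interior_of M)"
      using m by (auto simp: G_def)
  qed
  ultimately show "\<exists>T. openin ?X' T \<and> y \<in> T \<and> T \<subseteq> \<iota> ` (?X interior_of M)"
    by blast
qed

text \<open>On a neighbourhood of an interior point the local extension \<open>k\<close> coincides
  with the coordinate expression of the embedding, so the chain rule applies.\<close>

lemma differentiable_smooth_embedding:
  assumes atlas: "maximal_smooth_atlas (surf_top S) (surf_charts S)"
    "maximal_smooth_atlas (surf_top S') (surf_charts S')"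
    and M: "M \<subseteq> points S" and emb: "smooth_embedding S M S' \<iota>" and h: "smooth_function S' h"
    and c: "c \<in> surf_charts S" "p \<in> chart_dom c" "p \<in> surf_top S interior_of M"
  shows "((h \<circ> \<iota>) \<circ> chart_inv c) differentiable (at (chart_map c p))"
proof -
  let ?X = "surf_top S"
  have pM: "p \<in> M"
    using c(3) interior_of_subset[of ?X M] by blast
  have "\<iota> ` M \<subseteq> points S'"
    using emb embedding_map_subtopologyD(3)[OF _ M] unfolding smooth_embedding_def by blast
  then obtain d where d: "d \<in> surf_charts S'" "\<iota> p \<in> chart_dom d"
    using atlas_chart(2)[OF atlas(2)] pM by blast
  note ch = atlas_chart(1)[OF atlas(1) c(1)] and dh = atlas_chart(1)[OF atlas(2) d(1)]
  obtain W k where W: "open W" "chart_map c p \<in> W" "smooth_on W k"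
    and k: "\<And>q. q \<in> M \<inter> chart_dom c \<Longrightarrow> chart_map c q \<in> W \<Longrightarrow>
      \<iota> q \<in> chart_dom d \<and> chart_map d (\<iota> q) = k (chart_map c q)"
    using emb c(1,2) d pM unfolding smooth_embedding_def by (metis IntI)
  let ?D = "chart_map d ` chart_dom d"
  have D: "open ?D" "smooth_on ?D (h \<circ> chart_inv d)"
    using dh h d(1) by (auto simp: is_chart_def smooth_function_def)
  have kp: "k (chart_map c p) \<in> ?D"
    using k[of p] pM c(2) W(2) by force
  let ?z = "chart_map c p"
  have "((h \<circ> chart_inv d) \<circ> k has_derivative
      frechet_derivative (h \<circ> chart_inv d) (at (k ?z)) \<circ> frechet_derivative k (at ?z)) (at ?z)"
    by (rule diff_chain_at[OF smooth_on_imp(1)[OF W(3,1,2)] smooth_on_imp(1)[OF D(2,1) kp]])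
  moreover have "open (W \<inter> chart_map c ` (chart_dom c \<inter> ?X interior_of M))"
    using W(1) open_chart_image[OF ch openin_interior_of] by blast
  moreover have "?z \<in> W \<inter> chart_map c ` (chart_dom c \<inter> ?X interior_of M)"
    using W(2) c by blast
  moreover have "((h \<circ> chart_inv d) \<circ> k) z = ((h \<circ> \<iota>) \<circ> chart_inv c) z"
    if z: "z \<in> W \<inter> chart_map c ` (chart_dom c \<inter> ?X interior_of M)" for z
  proof -
    obtain q where q: "q \<in> chart_dom c" "q \<in> ?X interior_of M" "z = chart_map c q" "z \<in> W"
      using z by blast
    then have "q \<in> M \<inter> chart_dom c"
      using interior_of_subset[of ?X M] by blast
    then have "\<iota> q \<in> chart_dom d" "chart_map d (\<iota> q) = k z"
      using k[of q] q by auto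
    then have "chart_inv d (k z) = \<iota> q"
      using chart_inv_chart_map[OF dh] by metis
    then show ?thesis
      using chart_inv_chart_map[OF ch q(1)] q(3) by simp
  qed
  ultimately show ?thesis
    unfolding differentiable_def by (blast intro: has_derivative_transform_within_open)
qed

lemma card_components_embedding_image:
  assumes "embedding_map (subtopology X M) Z \<iota>" "M \<subseteq> topspace X" "U \<subseteq> M"
  shows "card (connected_components_of (subtopology Z (\<iota> ` U))) =
      card (connected_components_of (subtopology X U))"
    and "finite (connected_components_of (subtopology Z (\<iota> ` U))) \<longleftrightarrow>
      finite (connected_components_of (subtopology X U))"
proof -
  have tM: "topspace (subtopology X M) = M"
    using assms(2) by auto
  have h: "homeomorphic_map (subtopology X M) (subtopology Z (\<iota> ` M)) \<iota>"
    using assms(1) unfolding embedding_map_def tM .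
  have t: "topspace (subtopology Z (\<iota> ` M)) = \<iota> ` M"
    using homeomorphic_imp_surjective_map[OF h] unfolding tM by (rule sym)
  have "homeomorphic_map (subtopology (subtopology X M) U)
      (subtopology (subtopology Z (\<iota> ` M)) (\<iota> ` U)) \<iota>"
    by (rule homeomorphic_map_subtopologies[OF h])
       (use assms(3) t tM homeomorphic_imp_injective_map[OF h] in \<open>auto simp: inj_on_def\<close>)
  moreover have "subtopology (subtopology X M) U = subtopology X U"
    "subtopology (subtopology Z (\<iota> ` M)) (\<iota> ` U) = subtopology Z (\<iota> ` U)"
    using assms(3) by (simp_all add: subtopology_subtopology Int_absorb1 image_mono)
  ultimately have "connected_components_of (subtopology Z (\<iota> ` U)) =
      (`) \<iota> ` connected_components_of (subtopology X U)"
    using homeomorphic_map_connected_components_of by metis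
  moreover have "inj_on ((`) \<iota>) (connected_components_of (subtopology X U))"
  proof (rule inj_on_subset[OF inj_on_image_Pow])
    show "inj_on \<iota> U"
      using embedding_map_subtopologyD(1)[OF assms(1,2)] assms(3) inj_on_subset by blast
    show "connected_components_of (subtopology X U) \<subseteq> Pow U"
      using connected_components_of_subset[of _ "subtopology X U"] by fastforce
  qed
  ultimately show "card (connected_components_of (subtopology Z (\<iota> ` U))) =
      card (connected_components_of (subtopology X U))"
    "finite (connected_components_of (subtopology Z (\<iota> ` U))) \<longleftrightarrow>
      finite (connected_components_of (subtopology X U))"
    by (simp_all add: card_image finite_image_iff)
qed

text \<open>The comparison of a space with a closed piece, applied to the piece
  \<open>\<iota>\<close>
  M\<open>and the nodal set of\<close>h\<open>. As that set lies in\<close>\<iota> \<open>T\<close>,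
  it misses the image of the frontier of \<open>M\<close>.\<close>

lemma nodal_count_by_embedded_piece:
  assumes S: "closed_riemannian_surface S" "closed_riemannian_surface S'"
    and M: "compactin (surf_top S) M" "M \<noteq> {}"
    and emb: "embedding_map (subtopology (surf_top S) M) (surf_top S') \<iota>"
    and h: "smooth_function S' h"
    and T: "T \<subseteq> surf_top S interior_of M" and nodal: "nodal_set S' h \<subseteq> \<iota> ` T"
    and fin: "finite (connected_components_of (subtopology (surf_top S) {x\<in>M. h (\<iota> x) \<noteq> 0}))"
  shows "nodal_count S' h \<le>
      card (connected_components_of (subtopology (surf_top S) {x\<in>M. h (\<iota> x) \<noteq> 0}))" (is ?le)
    and "complement_components_meet_at_most_one (surf_top S') (\<iota> ` M)
        ((`) \<iota> ` boundary_components S M) \<Longrightarrow> nodal_count S' h =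
      card (connected_components_of (subtopology (surf_top S) {x\<in>M. h (\<iota> x) \<noteq> 0}))"
proof -
  let ?X = "surf_top S" and ?X' = "surf_top S'" and ?N = "nodal_set S' h" and ?U = "{x\<in>M. h (\<iota> x) \<noteq> 0}"
  note a = closed_surface[OF S(1)] and a' = closed_surface[OF S(2)]
  have MX: "M \<subseteq> points S"
    by (rule compactin_subset_topspace[OF M(1)])
  note \<iota> = embedding_map_subtopologyD[OF emb MX]
  have clM: "closedin ?X M"
    by (rule compactin_imp_closedin[OF a(4) M(1)])
  have "compactin (subtopology ?X M) M"
    using M(1) by (simp add: compactin_subtopology)
  then have clP: "closedin ?X' (\<iota> ` M)"
    using compactin_imp_closedin[OF a'(4)] image_compactin \<iota>(2) by blast
  have "{x \<in> points S'. h x \<in> {0}} = ?N"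
    by (auto simp: nodal_set_def)
  then have clN: "closedin ?X' ?N"
    using closedin_continuous_map_preimage[OF continuous_map_smooth_function[OF a'(5) h], of "{0}"] by simp
  have TM: "T \<subseteq> M"
    using T interior_of_subset[of ?X M] by blast
  have NP: "?N \<subseteq> \<iota> ` M"
    using nodal TM by blast
  let ?F = "?X frontier_of M"
  have FM: "?F \<subseteq> M" "M - ?X interior_of M = ?F"
    using clM by (auto simp: frontier_of_def closure_of_closedin)
  have "\<iota> ` (?X interior_of M) \<subseteq> ?X' interior_of (\<iota> ` M)"
    by (rule interior_of_maximal)
       (use interior_of_subset[of ?X M] openin_embedding_image_interior[OF a(5) a'(5) MX emb] in auto)
  \<comment> \<open>A frontier point of the closed image is no interior point of it, so its preimage
    cannot be interior to \<open>M\<close>.\<close>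
  then have fr: "?X' frontier_of (\<iota> ` M) \<subseteq> \<iota> ` ?F"
    using clP FM(2) by (auto simp: frontier_of_def closure_of_closedin)
  have FN: "\<iota> ` ?F \<subseteq> \<iota> ` M - ?N"
  proof
    fix y assume "y \<in> \<iota> ` ?F"
    then obtain x where x: "x \<in> ?F" "y = \<iota> x"
      by blast
    have "y \<notin> ?N"
    proof
      assume "y \<in> ?N"
      then obtain u where "u \<in> T" "y = \<iota> u"
        using nodal by blast
      then have "x = u"
        using inj_onD[OF \<iota>(1)] x FM(1) TM by blast
      then show False
        using x \<open>u \<in> T\<close> T FM(2) by blast
    qed
    then show "y \<in> \<iota> ` M - ?N"
      using x FM by blast
  qed
  have PN: "\<iota> ` M - ?N = \<iota> ` ?U"
    using \<iota>(3) by (auto simp: nodal_set_def)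
  have fin': "finite (connected_components_of (subtopology ?X' (\<iota> ` M - ?N)))"
    unfolding PN using card_components_embedding_image(2)[OF emb MX, of ?U] fin by blast
  have card: "card (connected_components_of (subtopology ?X' (\<iota> ` M - ?N))) =
      card (connected_components_of (subtopology ?X ?U))"
    unfolding PN by (rule card_components_embedding_image(1)[OF emb MX]) blast
  have lc: "locally_connected_space ?X'"
    by (rule locally_connected_space_atlas[OF a'(5)])
  have P: "\<iota> ` M \<noteq> {}"
    using M(2) by blast
  show ?le
    unfolding nodal_count_def card[symmetric]
    by (rule card_components_le_piece[OF a'(3) lc clP P NP _ fin']) (use fr FN in blast)
  assume one: "complement_components_meet_at_most_one ?X' (\<iota> ` M) ((`) \<iota> ` boundary_components S M)"
  have "\<Union>(boundary_components S M) = ?F"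
    unfolding boundary_components_def
    using Union_connected_components_of[of "subtopology ?X ?F"] frontier_of_subset_topspace[of ?X M] by auto
  then have UB: "\<Union>((`) \<iota> ` boundary_components S M) = \<iota> ` ?F"
    by (simp flip: image_Union)
  show "nodal_count S' h = card (connected_components_of (subtopology ?X ?U))"
    unfolding nodal_count_def card[symmetric]
  proof (rule card_components_eq_piece[OF a'(3) lc clP P NP clN _ _ _ one fin'])
    fix B assume "B \<in> (`) \<iota> ` boundary_components S M"
    then obtain E where E: "E \<in> connected_components_of (subtopology ?X ?F)" "B = \<iota> ` E"
      by (auto simp: boundary_components_def)
    have "connectedin ?X E" "E \<subseteq> ?F"
      using connectedin_connected_components_of[OF E(1)] by (auto simp: connectedin_subtopology)
    then have "connectedin (subtopology ?X M) E"
      using FM(1) by (simp add: connectedin_subtopology)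
    then show "connectedin ?X' B"
      unfolding E(2) by (rule connectedin_continuous_map_image[OF \<iota>(2)])
  qed (use UB fr FN in auto)
qed

text \<open>Serves the case of empty \<open>M\<close>, where there is no piece to represent the
  components.\<close>

lemma nodal_count_nodal_set_empty:
  assumes "closed_riemannian_surface S" "nodal_set S h = {}"
  shows "nodal_count S h = 1"
  using closed_surface[OF assms(1)] assms(2)
  by (simp add: nodal_count_def connected_components_of_connected_space)

theorem theorem5p1:
  fixes A :: "real set" and S :: "real \<Rightarrow> 'a surface" and M T :: "'a set"
    and \<iota> :: "real \<Rightarrow> 'a \<Rightarrow> 'a" and lam :: "real \<Rightarrow> nat \<Rightarrow> real"
    and \<phi> :: "real \<Rightarrow> 'a \<Rightarrow> real" and k :: nat
  assumes perturbation: "localised_perturbation A S M \<iota> lam"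
    and k: "k \<ge> 1"
    and eigenfunctions: "\<And>t. t \<in> insert 0 A \<Longrightarrow> laplace_eigenfunction (S t) (lam t k) (\<phi> t)"
    and convergence: "functions_Cinf_loc_limit (S 0) (surf_top (S 0) interior_of M)
                        (\<lambda>t. \<phi> t \<circ> \<iota> t) (\<phi> 0) (at 0 within A)"
    and subsurface: "compact_subsurface (S 0) M"
    and a0: "regular_value_on (S 0) M (\<phi> 0) 0"
    and at: "\<forall>\<^sub>F t in at 0 within A. regular_value_on (S 0) M (\<phi> t \<circ> \<iota> t) 0"
    and T: "compactin (surf_top (S 0)) T" "T \<subseteq> surf_top (S 0) interior_of M"
    and b0: "nodal_set (S 0) (\<phi> 0) \<subseteq> T"
    and bt: "\<forall>\<^sub>F t in at 0 within A. nodal_set (S t) (\<phi> t) \<subseteq> \<iota> t ` T"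
    and c: "complement_components_meet_at_most_one (surf_top (S 0)) M (boundary_components (S 0) M)"
  shows "(\<forall>\<^sub>F t in at 0 within A. nodal_count (S t) (\<phi> t) \<le> nodal_count (S 0) (\<phi> 0)) \<and>
    ((\<forall>\<^sub>F t in at 0 within A. complement_components_meet_at_most_one (surf_top (S t)) (\<iota> t ` M)
        ((`) (\<iota> t) ` boundary_components (S 0) M)) \<longrightarrow>
     (\<forall>\<^sub>F t in at 0 within A. nodal_count (S t) (\<phi> t) = nodal_count (S 0) (\<phi> 0)))"
proof -
  let ?F = "at 0 within A" and ?X = "surf_top (S 0)"
  have evA: "\<forall>\<^sub>F t in ?F. t \<in> A"
    by (simp add: eventually_at_filter)
  have closed: "closed_riemannian_surface (S t)" if "t \<in> insert 0 A" for t
    using perturbation that unfolding localised_perturbation_def by blast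
  have smooth: "smooth_function (S t) (\<phi> t)" if "t \<in> insert 0 A" for t
    using eigenfunctions[OF that] unfolding laplace_eigenfunction_def solves_eigen_equation_def by blast
  have emb: "\<forall>\<^sub>F t in ?F. smooth_embedding (S 0) M (S t) (\<iota> t)"
    using perturbation unfolding localised_perturbation_def by blast
  have M: "compactin ?X M" "M \<subseteq> points (S 0)"
    using subsurface compactin_subset_topspace by (auto simp: compact_subsurface_def)
  show ?thesis
  proof (cases "M = {}")
    \<comment> \<open>Both nodal sets are contained in images of the empty set, so each surface is a
      single nodal domain.\<close>
    case True
    then have "T = {}"
      using T(2) by simp
    then have "nodal_count (S 0) (\<phi> 0) = 1"
      using nodal_count_nodal_set_empty closed b0 by blast
    moreover have "\<forall>\<^sub>F t in ?F. nodal_count (S t) (\<phi> t) = 1"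
      using evA bt by eventually_elim (use nodal_count_nodal_set_empty closed \<open>T = {}\<close> in blast)
    ultimately show ?thesis
      by (auto elim: eventually_mono)
  next
    case False
    note a0' = closed_surface[OF closed[of 0]]
    have TM: "T \<subseteq> M"
      using T(2) interior_of_subset[of ?X M] by blast
    interpret L: nodal_limit "S 0" M T "\<phi> 0" "\<lambda>t. \<phi> t \<circ> \<iota> t" ?F
    proof
      show "{p \<in> M. \<phi> 0 p = 0} \<subseteq> T"
        using b0 M(2) by (auto simp: nodal_set_def)
      show "\<forall>\<^sub>F t in ?F. {p \<in> M. (\<phi> t \<circ> \<iota> t) p = 0} \<subseteq> T"
        using emb bt
      proof eventually_elim
        case (elim t)
        note \<iota> = embedding_map_subtopologyD[OF _ M(2), of "surf_top (S t)" "\<iota> t"]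
        have e: "embedding_map (subtopology ?X M) (surf_top (S t)) (\<iota> t)"
          using elim(1) by (simp add: smooth_embedding_def)
        show ?case
        proof clarify
          fix p assume p: "p \<in> M" "(\<phi> t \<circ> \<iota> t) p = 0"
          then have "\<iota> t p \<in> \<iota> t ` T"
            using elim(2) \<iota>(3)[OF e] by (auto simp: nodal_set_def)
          then show "p \<in> T"
            using inj_onD[OF \<iota>(1)[OF e]] p(1) TM by blast
        qed
      qed
      show "\<forall>\<^sub>F t in ?F. continuous_map (subtopology ?X M) euclideanreal (\<phi> t \<circ> \<iota> t)"
        using emb evA
      proof eventually_elim
        case (elim t)
        then have "continuous_map (surf_top (S t)) euclideanreal (\<phi> t)"
          using continuous_map_smooth_function closed_surface(5)[OF closed] smooth by blast
        then show ?case
          using elim(1) embedding_map_subtopologyD(2)[OF _ M(2)] continuous_map_compose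
          unfolding smooth_embedding_def by blast
      qed
      show "\<forall>\<^sub>F t in ?F. \<forall>c\<in>surf_charts (S 0). \<forall>p\<in>chart_dom c \<inter> ?X interior_of M.
          (\<phi> t \<circ> \<iota> t \<circ> chart_inv c) differentiable at (chart_map c p)"
        using emb evA
      proof eventually_elim
        case (elim t)
        then show ?case
          using differentiable_smooth_embedding[OF a0'(5) closed_surface(5)[OF closed] M(2) elim(1) smooth]
          by blast
      qed
    qed (use a0' subsurface T smooth a0 convergence in auto)
    let ?n = "card (connected_components_of (subtopology ?X {x\<in>M. \<phi> 0 x \<noteq> 0}))"
    let ?m = "\<lambda>t. card (connected_components_of (subtopology ?X {x\<in>M. \<phi> t (\<iota> t x) \<noteq> 0}))"
    have ev: "\<forall>\<^sub>F t in ?F. finite (connected_components_of (subtopology ?X {x\<in>M. \<phi> 0 x \<noteq> 0})) \<and>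
        finite (connected_components_of (subtopology ?X {x\<in>M. \<phi> t (\<iota> t x) \<noteq> 0})) \<and> ?n = ?m t"
      using L.eventually_card_components by simp
    have le: "\<forall>\<^sub>F t in ?F. nodal_count (S t) (\<phi> t) \<le> ?n"
      using ev emb evA bt
    proof eventually_elim
      case (elim t)
      have "nodal_count (S t) (\<phi> t) \<le> ?m t"
        by (rule nodal_count_by_embedded_piece(1)[of "S 0" "S t" M "\<iota> t" "\<phi> t" T])
           (use elim closed smooth M(1) False T(2) in \<open>auto simp: smooth_embedding_def\<close>)
      then show ?case
        using elim by simp
    qed
    have eq: "\<forall>\<^sub>F t in ?F. nodal_count (S t) (\<phi> t) = ?n"
      if "\<forall>\<^sub>F t in ?F. complement_components_meet_at_most_one (surf_top (S t)) (\<iota> t ` M)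
        ((`) (\<iota> t) ` boundary_components (S 0) M)"
      using ev emb evA bt that
    proof eventually_elim
      case (elim t)
      have "nodal_count (S t) (\<phi> t) = ?m t"
        by (rule nodal_count_by_embedded_piece(2)[of "S 0" "S t" M "\<iota> t" "\<phi> t" T])
           (use elim closed smooth M(1) False T(2) in \<open>auto simp: smooth_embedding_def\<close>)
      then show ?case
        using elim by simp
    qed
    have "\<forall>\<^sub>F t in ?F. nodal_count (S 0) (\<phi> 0) = ?n"
      using ev
    proof eventually_elim
      case (elim t)
      \<comment> \<open>The base surface counts as embedded by the identity, and condition
        \<open>c\<close> yields equality. The statement is phrased eventually because the required
        finiteness comes from \<open>ev\<close>.\<close>
      have "embedding_map (subtopology ?X M) ?X (\<lambda>x. x)"
        using M(2) homeomorphic_map_id[of "subtopology ?X M"]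
        by (simp add: embedding_map_def id_def Int_absorb1)
      then show ?case
        using nodal_count_by_embedded_piece(2)[of "S 0" "S 0" M "\<lambda>x. x" "\<phi> 0" T]
          closed[of 0] smooth[of 0] M(1) False T(2) b0 c elim by simp
    qed
    then show ?thesis
      using le eq by (auto elim: eventually_elim2)
  qed
qed

end
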